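(* Let $N\in\mathbb{F}_q(t^p)[Y]$ be monic, irreducible and separable over $\mathbb{F}_q(t^p)$, and let $\nu\ge 1$ be an integer. Then there is a ring isomorphism $$\mathcal{D}_{N(\partial^p)^\nu}\simeq \mathcal{D}_{N(\partial^p)}[T]/(T^\nu),$$ where $T$ is a central indeterminate (and under which $T$ corresponds to the class of $N(\partial^p)$).
   Context: Let $p$ be a prime, $q=p^n$. $\mathbb{F}_q(t)\langle\partial\rangle$ is the ring of linear differential operators with coefficients in $\mathbb{F}_q(t)$, multiplication given by $\partial f=f\partial+\frac{df}{dt}$. For $P\in\mathbb{F}_q(t^p)[Y]$, $P(\partial^p)$ is central in $\mathbb{F}_q(t)\langle\partial\rangle$, so $\mathcal{D}_{P(\partial^p)}:=\mathbb{F}_q(t)\langle\partial\rangle/\mathbb{F}_q(t)\langle\partial\rangle P(\partial^p)$ is a quotient by a two-sided ideal and hence a ring. (For $N$ irreducible, $\mathcal{D}_{N(\partial^p)}$ is a central simple algebra of dimension $p^2$ over $C_N=\mathbb{F}_q(t^p)[Y]/(N)$.) *)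

theory Defs
  imports "HOL-Computational_Algebra.Fraction_Field" "HOL-Computational_Algebra.Polynomial"
          "HOL-Algebra.QuotRing" "HOL-Algebra.UnivPoly" "HOL-Algebra.Ideal"
begin

text \<open>F_q(t) is rendered as the type 'k poly fract for a finite field 'k (= F_q);
  its characteristic p is CHAR('k).  The derivation d/dt on F_q(t), via the quotient rule.\<close>
definition ddt :: "'k::field poly fract \<Rightarrow> 'k poly fract" where
  "ddt x = (THE y. \<forall>a b. b \<noteq> 0 \<longrightarrow> x = Fraction_Field.Fract a b \<longrightarrow>
              y = Fraction_Field.Fract (pderiv a * b - a * pderiv b) (b * b))"

definition Ftp :: "'k::{field,finite} poly fract set" where
  "Ftp = {Fraction_Field.Fract (pcompose a (Polynomial.monom 1 CHAR('k))) (pcompose b (Polynomial.monom 1 CHAR('k))) | a b. b \<noteq> 0}"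

text \<open>Differential operators: an element  sum_i a_i \<partial>^i  (coefficients on the left) is the
  polynomial with coefficients a_i.  Multiplication uses \<partial>^i b = sum_k (i choose k) b^(k) \<partial>^(i-k),
  which is the rule  \<partial> f = f \<partial> + df/dt  extended.\<close>
definition ore_mult :: "'k::field poly fract poly \<Rightarrow> 'k poly fract poly \<Rightarrow> 'k poly fract poly" where
  "ore_mult A B = (\<Sum>i\<le>degree A. \<Sum>j\<le>degree B. \<Sum>k\<le>i.
      Polynomial.monom (of_nat (i choose k) * Polynomial.coeff A i * (ddt ^^ k) (Polynomial.coeff B j)) (i + j - k))"

definition OreRing :: "'k::field poly fract poly ring" where
  "OreRing = \<lparr>carrier = UNIV, mult = ore_mult, one = 1, zero = 0, add = (+)\<rparr>"

definition at_dp :: "'k::{field,finite} poly fract poly \<Rightarrow> 'k poly fract poly" where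
  "at_dp P = (\<Sum>i\<le>degree P. Polynomial.monom (Polynomial.coeff P i) (CHAR('k) * i))"

text \<open>Left ideal generated by L (it is two-sided when L is central).\<close>
definition left_ideal_gen :: "'k::field poly fract poly \<Rightarrow> 'k poly fract poly set" where
  "left_ideal_gen L = {ore_mult A L | A. True}"

definition Dquot :: "'k::field poly fract poly \<Rightarrow> 'k poly fract poly set ring" where
  "Dquot L = OreRing Quot left_ideal_gen L"

definition poly_over :: "'a::zero set \<Rightarrow> 'a poly \<Rightarrow> bool" where
  "poly_over K P \<longleftrightarrow> (\<forall>i. Polynomial.coeff P i \<in> K)"

definition irreducible_over :: "'a::field set \<Rightarrow> 'a poly \<Rightarrow> bool" where
  "irreducible_over K P \<longleftrightarrow> poly_over K P \<and> degree P > 0 \<and>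
     (\<forall>A B. poly_over K A \<longrightarrow> poly_over K B \<longrightarrow> P = A * B \<longrightarrow> degree A = 0 \<or> degree B = 0)"

definition separable_over :: "'a::field set \<Rightarrow> 'a poly \<Rightarrow> bool" where
  "separable_over K P \<longleftrightarrow> poly_over K P \<and>
     (\<forall>D. poly_over K D \<longrightarrow> D dvd P \<longrightarrow> D dvd pderiv P \<longrightarrow> degree D = 0)"

end

(*
  A differential operator is identified with its symbol, and \<partial> acts on symbols by the connection
  "d/dt coefficientwise plus multiplication by the variable". In this picture an operator P(\<partial>^p) acts
  as ordinary multiplication by P(X^p), so the quotients are by ordinary divisibility.

  For a central H, the substitution \<partial> -> \<partial> + H/t is an endomorphism, and since
  t^p \<partial>^p = \<theta>^p - \<theta> for the Euler operator \<theta> = t\<partial>, it sends \<partial>^p to \<partial>^p + (H^p - H)/t^p. As N is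
  separable, a Newton iteration produces H divisible by N such that this endomorphism maps N(\<partial>^p) into
  the ideal of N(\<partial>^p)^\<nu>. It thus lifts the quotient by N(\<partial>^p) to the quotient by N(\<partial>^p)^\<nu>, and
  expanding elements in powers of N(\<partial>^p) with lifted coefficients gives the isomorphism.
*)
theory Submission
  imports Defs
begin

hide_const (open) up_ring.monom up_ring.coeff module.smult

text \<open>By Hensel's lemma the central ring of polynomials modulo N^\<nu> contains a root of N
  congruent to Y modulo N. To lift the noncommutative quotient, this root must also be the p-th
  power of some lift of \<partial>, so it is sought among the values (\<partial> + f)^p. The factor
  1/t comes from the formula (\<partial> + f)^p = \<partial>^p + f^p + f^(p-1), where the last term
  is the derivative of order p - 1. For f with zero derivative only f^p is added; it has no linear
  part, so a Newton step has nothing to invert. For f = H/t the last term is (p-1)! H/t^p = -H/t^p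
  by Wilson's theorem. This linear part can absorb the error, while the p-th power of a small
  correction is negligible.\<close>

lemma CHAR_fract: "CHAR('a::idom fract) = CHAR('a)"
proof (rule CHAR_eqI)
  show "of_nat CHAR('a) = (0 :: 'a fract)"
    by (simp add: of_nat_fract Zero_fract_def)
next
  fix n assume "of_nat n = (0 :: 'a fract)"
  then show "CHAR('a) dvd n"
    by (simp add: of_nat_fract Zero_fract_def eq_fract of_nat_eq_0_iff_char_dvd)
qed

lemma CHAR_poly_idom: "CHAR('a::idom poly) = CHAR('a)"
  by (rule CHAR_eqI) (auto simp: of_nat_poly of_nat_eq_0_iff_char_dvd)

lemma prime_CHAR_finite: "prime CHAR('k::{field,finite})"
  by (intro prime_CHAR_semidom finite_imp_CHAR_pos) simp

lemma prime_CHAR_coeffs [simp]: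
  "prime CHAR('k::{field,finite} poly fract)"
  "prime CHAR('k::{field,finite} poly fract poly)"
  "prime CHAR('k::{field,finite} poly fract poly poly)"
  by (simp_all only: CHAR_fract CHAR_poly_idom prime_CHAR_finite)

subsection \<open>The derivation on the field of rational functions\<close>

text \<open>Independence of the representative: equality of fractions is
  \<open>a * d = c * b\<close>, and the cross-multiplied numerator can be written using only this
  product, its derivative and the denominators.\<close>

lemma ddt_Fract:
  assumes "b \<noteq> 0"
  shows "ddt (Fraction_Field.Fract a b) =
    Fraction_Field.Fract (pderiv a * b - a * pderiv b) (b * b)"
  unfolding ddt_def
proof (rule the_equality)
  show "\<forall>c d. d \<noteq> 0 \<longrightarrow> Fraction_Field.Fract a b = Fraction_Field.Fract c d \<longrightarrow>
      Fraction_Field.Fract (pderiv a * b - a * pderiv b) (b * b) =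
      Fraction_Field.Fract (pderiv c * d - c * pderiv d) (d * d)"
  proof (intro allI impI)
    fix c d assume d: "d \<noteq> 0" and "Fraction_Field.Fract a b = Fraction_Field.Fract c d"
    then have ad: "a * d = c * b"
      using assms by (simp add: eq_fract)
    then have ad': "pderiv a * d + a * pderiv d = pderiv c * b + c * pderiv b"
      by (metis (no_types) pderiv_mult add.commute mult.commute)
    have "(pderiv a * b - a * pderiv b) * (d * d) =
        (pderiv a * d + a * pderiv d) * (b * d) - (a * d) * (pderiv d * b + pderiv b * d)"
      by (simp add: algebra_simps)
    also have "\<dots> = (pderiv c * d - c * pderiv d) * (b * b)"
      unfolding ad ad' by (simp add: algebra_simps)
    finally show "Fraction_Field.Fract (pderiv a * b - a * pderiv b) (b * b) =
        Fraction_Field.Fract (pderiv c * d - c * pderiv d) (d * d)"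
      using assms d by (simp add: eq_fract)
  qed
qed (use assms in blast)

lemma ddt_add: "ddt (x + y) = ddt x + ddt y"
  by (cases x; cases y) (simp add: ddt_Fract eq_fract pderiv_mult pderiv_add algebra_simps)

lemma ddt_mult: "ddt (x * y) = ddt x * y + x * ddt y"
  by (cases x; cases y) (simp add: ddt_Fract eq_fract pderiv_mult pderiv_add algebra_simps)

lemma ddt_0 [simp]: "ddt 0 = 0"
  by (metis add.right_neutral add_left_cancel ddt_add)

lemma ddt_1 [simp]: "ddt 1 = 0"
  by (metis add.right_neutral add_left_cancel ddt_mult mult_1 mult_1_right)

lemma ddt_of_nat [simp]: "ddt (of_nat n) = 0"
  by (induction n) (simp_all add: ddt_add)

lemma ddt_minus: "ddt (- x) = - ddt x"
  using ddt_add[of x "- x"] by (simp add: eq_neg_iff_add_eq_0 add.commute)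

lemma ddt_mult_const: "ddt c = 0 \<Longrightarrow> (ddt ^^ n) (x * c) = (ddt ^^ n) x * c"
  by (induction n) (simp_all add: ddt_mult)

lemma higher_ddt_0 [simp]: "(ddt ^^ n) 0 = 0"
  by (induction n) simp_all

lemma higher_ddt_polynomial:
  "(ddt ^^ n) (Fraction_Field.Fract a 1) = Fraction_Field.Fract ((pderiv ^^ n) a) 1"
  by (induction n) (simp_all add: ddt_Fract)

text \<open>Each coefficient acquires the factor (n+1)...(n+p), which is p! times a binomial
  coefficient and so vanishes in characteristic p.\<close>

lemma higher_pderiv_CHAR: "(pderiv ^^ CHAR('k)) (a :: 'k::{field,finite} poly) = 0"
proof (rule poly_eqI)
  fix n
  let ?p = "CHAR('k)"
  have "fact n * pochhammer (Suc n) ?p = fact n * (fact ?p * ((n + ?p) choose ?p))"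
    using binomial_fact_lemma[of ?p "n + ?p"] pochhammer_product'[of "1::nat" n ?p]
    by (metis mult.commute mult.left_commute add_diff_cancel_right' le_add2 of_nat_id plus_1_eq_Suc
        pochhammer_fact)
  then have "pochhammer (Suc n) ?p = fact ?p * ((n + ?p) choose ?p)"
    by simp
  moreover have "?p dvd fact ?p"
    by (simp add: dvd_fact finite_imp_CHAR_pos Suc_leI)
  ultimately have "?p dvd pochhammer (Suc n) ?p"
    by simp
  then have "pochhammer (of_nat (Suc n)) CHAR('k) = (0 :: 'k)"
    by (metis of_nat_eq_0_iff_char_dvd pochhammer_of_nat)
  then show "poly.coeff ((pderiv ^^ CHAR('k)) a) n = poly.coeff 0 n"
    by (simp add: coeff_higher_pderiv)
qed

lemma pderiv_power_CHAR: "pderiv (b ^ CHAR('k)) = (0 :: 'k::{field,finite} poly)"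
  by (simp add: pderiv_power of_nat_poly)

text \<open>Writing a/b as a b^(p-1) / b^p makes the denominator a constant of the derivation, which
  reduces the claim to polynomials.\<close>

lemma higher_ddt_CHAR: "(ddt ^^ CHAR('k)) (x :: 'k::{field,finite} poly fract) = 0"
proof (cases x)
  case (Fract a b)
  let ?p = "CHAR('k)"
  have p: "?p > 0"
    by (simp add: finite_imp_CHAR_pos)
  have "x = Fraction_Field.Fract (a * b ^ (?p - 1)) 1 * Fraction_Field.Fract 1 (b ^ ?p)"
    using Fract p by (simp add: eq_fract power_eq_if[of b ?p])
  moreover have "ddt (Fraction_Field.Fract 1 (b ^ ?p)) = 0"
    using Fract by (simp add: ddt_Fract pderiv_power_CHAR fract_collapse)
  ultimately show ?thesis
    by (simp add: ddt_mult_const higher_ddt_polynomial higher_pderiv_CHAR fract_collapse del: mult_fract)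
qed

subsection \<open>Connections and the action of differential operators\<close>

text \<open>The potential \<open>W\<close> is a parameter because two connections occur:
  \<open>W = X\<close> for \<partial> itself, and \<open>W = X + H/t\<close> for its twisted
  image.\<close>

definition conn :: "'k::field poly fract poly \<Rightarrow> 'k poly fract poly \<Rightarrow> 'k poly fract poly" where
  "conn W C = map_poly ddt C + W * C"

definition ev ::
  "('k::field poly fract poly \<Rightarrow> 'k poly fract poly) \<Rightarrow> 'k poly fract poly \<Rightarrow> 'k poly fract poly \<Rightarrow> 'k poly fract poly"
  where "ev E A C = (\<Sum>i\<le>degree A. Polynomial.smult (poly.coeff A i) ((E ^^ i) C))"

lemma map_poly_ddt_add: "map_poly ddt (A + B) = map_poly ddt A + map_poly ddt B"
  by (rule poly_eqI) (simp add: coeff_map_poly ddt_add)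

lemma map_poly_ddt_smult:
  "map_poly ddt (Polynomial.smult b A) = Polynomial.smult b (map_poly ddt A) + Polynomial.smult (ddt b) A"
  by (rule poly_eqI) (simp add: coeff_map_poly ddt_mult)

lemma map_poly_ddt_pCons: "map_poly ddt (pCons a A) = pCons (ddt a) (map_poly ddt A)"
  by (simp add: map_poly_pCons)

lemma map_poly_ddt_mult: "map_poly ddt (A * B) = map_poly ddt A * B + A * map_poly ddt B"
proof (induction A)
  case (pCons a A)
  then show ?case
    by (simp add: map_poly_ddt_add map_poly_ddt_smult map_poly_ddt_pCons algebra_simps)
qed simp

lemma conn_add: "conn W (A + B) = conn W A + conn W B"
  by (simp add: conn_def map_poly_ddt_add algebra_simps)

lemma conn_0 [simp]: "conn W 0 = 0"
  by (simp add: conn_def)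

lemma conn_smult:
  "conn W (Polynomial.smult b A) = Polynomial.smult b (conn W A) + Polynomial.smult (ddt b) A"
  by (simp add: conn_def map_poly_ddt_smult algebra_simps smult_add_right)

lemma conn_mult: "conn W (H * C) = map_poly ddt H * C + H * conn W C"
  by (simp add: conn_def map_poly_ddt_mult algebra_simps)

lemma conn_sum: "conn W (\<Sum>i\<in>I. f i) = (\<Sum>i\<in>I. conn W (f i))"
  by (induction I rule: infinite_finite_induct) (simp_all add: conn_add)

lemma funpow_conn_sum: "(conn W ^^ n) (\<Sum>i\<in>I. f i) = (\<Sum>i\<in>I. (conn W ^^ n) (f i))"
  by (induction n) (simp_all add: conn_sum)

lemma smult_sum_right: "Polynomial.smult a (\<Sum>i\<in>I. f i) = (\<Sum>i\<in>I. Polynomial.smult a (f i))"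
  by (induction I rule: infinite_finite_induct) (simp_all add: smult_add_right)

lemma ev_le:
  "degree A \<le> n \<Longrightarrow> ev E A C = (\<Sum>i\<le>n. Polynomial.smult (poly.coeff A i) ((E ^^ i) C))"
  unfolding ev_def by (rule sum.mono_neutral_left) (auto simp: coeff_eq_0)

lemma ev_0 [simp]: "ev E 0 C = 0"
  by (simp add: ev_def)

lemma ev_pCons: "ev E (pCons a A) C = Polynomial.smult a C + ev E A (E C)"
proof -
  have "ev E (pCons a A) C =
      (\<Sum>i\<le>Suc (degree A). Polynomial.smult (poly.coeff (pCons a A) i) ((E ^^ i) C))"
    by (rule ev_le) (simp add: degree_pCons_le)
  also have "\<dots> = Polynomial.smult a C +
      (\<Sum>i\<le>degree A. Polynomial.smult (poly.coeff A i) ((E ^^ i) (E C)))"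
    by (simp add: sum.atMost_Suc_shift funpow_swap1 del: sum.atMost_Suc)
  finally show ?thesis
    by (simp add: ev_def)
qed

lemma ev_1 [simp]: "ev E 1 C = C"
  using ev_pCons[of E 1 0 C] by (simp add: one_pCons)

lemma ev_add_left: "ev E (A + B) C = ev E A C + ev E B C"
  by (induction A B arbitrary: C rule: poly_induct2)
    (simp_all add: ev_pCons smult_add_left)

lemma ev_smult: "ev E (Polynomial.smult b A) C = Polynomial.smult b (ev E A C)"
  by (induction A arbitrary: C) (simp_all add: ev_pCons smult_add_right)

lemma ev_conn_0_right [simp]: "ev (conn W) A 0 = 0"
  by (induction A) (simp_all add: ev_pCons)

lemma ev_conn_add: "ev (conn W) A (B + C) = ev (conn W) A B + ev (conn W) A C"
  by (induction A arbitrary: B C) (simp_all add: ev_pCons smult_add_right conn_add)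

lemma ev_conn_mult_const:
  "map_poly ddt H = 0 \<Longrightarrow> ev (conn W) A (H * C) = H * ev (conn W) A C"
  by (induction A arbitrary: C) (simp_all add: ev_pCons conn_mult distrib_left)

abbreviation dop :: "'k::field poly fract poly \<Rightarrow> 'k poly fract poly" where
  "dop \<equiv> conn [:0, 1:]"

lemma dop_altdef: "dop C = map_poly ddt C + pCons 0 C"
  by (simp add: conn_def)

lemma dop_monom:
  "dop (Polynomial.monom b n) = Polynomial.monom (ddt b) n + Polynomial.monom b (Suc n)"
  by (simp add: dop_altdef map_poly_monom monom_Suc)

text \<open>Any connection satisfies E b = b E + b', the defining relation of the operator ring, so
  substituting it for \<partial> respects left multiplication by \<partial>.\<close>

lemma ev_dop: "ev (conn W) (dop B) C = conn W (ev (conn W) B C)"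
proof (induction B arbitrary: C)
  case (pCons b B)
  have "dop (pCons b B) = pCons (ddt b) (dop B) + [:0, b:]"
    by (simp add: dop_altdef map_poly_ddt_pCons)
  then show ?case
    by (simp add: ev_add_left ev_pCons pCons.IH conn_add conn_smult algebra_simps)
qed simp

text \<open>Pascal's rule. Up to the left coefficient, the right-hand side is the innermost sum in
  the definition of \<open>ore_mult\<close>.\<close>

lemma funpow_dop_monom:
  "(dop ^^ n) (Polynomial.monom b j) =
    (\<Sum>k\<le>n. Polynomial.monom (of_nat (n choose k) * (ddt ^^ k) b) (n + j - k))"
proof (induction n)
  case (Suc n)
  let ?t = "\<lambda>m k. Polynomial.monom (of_nat (m choose k) * (ddt ^^ k) b) (Suc n + j - k)"
  let ?s = "\<lambda>k. Polynomial.monom (of_nat (n choose k) * (ddt ^^ Suc k) b) (n + j - k)"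
  have d: "dop (Polynomial.monom (of_nat (n choose k) * (ddt ^^ k) b) (n + j - k)) = ?s k + ?t n k"
    if "k \<le> n" for k
    using that by (simp add: dop_monom ddt_mult Suc_diff_le)
  have "(dop ^^ Suc n) (Polynomial.monom b j) = (\<Sum>k\<le>n. ?s k + ?t n k)"
    using d by (simp add: Suc.IH conn_sum)
  also have "\<dots> = (\<Sum>k\<le>n. ?s k) + (\<Sum>k\<le>Suc n. ?t n k)"
    by (simp add: sum.distrib binomial_eq_0)
  also have "\<dots> = (\<Sum>k\<le>n. ?s k) + (?t n 0 + (\<Sum>k\<le>n. ?t n (Suc k)))"
    by (subst sum.atMost_Suc_shift) (simp add: binomial_eq_0)
  also have "\<dots> = ?t (Suc n) 0 + (\<Sum>k\<le>n. ?s k + ?t n (Suc k))"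
    by (simp add: sum.distrib)
  also have "(\<Sum>k\<le>n. ?s k + ?t n (Suc k)) =
      (\<Sum>k\<le>n. Polynomial.monom (of_nat (Suc n choose Suc k) * (ddt ^^ Suc k) b) (Suc n + j - Suc k))"
    by (intro sum.cong) (simp_all add: add_monom algebra_simps)
  also have "?t (Suc n) 0 + \<dots> =
      (\<Sum>k\<le>Suc n. Polynomial.monom (of_nat (Suc n choose k) * (ddt ^^ k) b) (Suc n + j - k))"
    by (subst sum.atMost_Suc_shift) (simp add: binomial_eq_0)
  finally show ?case .
qed simp

lemma ore_mult_eq_ev: "ore_mult A B = ev dop A B"
proof -
  have "(dop ^^ i) B = (\<Sum>j\<le>degree B. \<Sum>k\<le>i.
      Polynomial.monom (of_nat (i choose k) * (ddt ^^ k) (poly.coeff B j)) (i + j - k))" for i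
    by (subst (1) poly_as_sum_of_monoms[symmetric, of B])
      (simp only: funpow_conn_sum funpow_dop_monom)
  then show ?thesis
    by (simp add: ore_mult_def ev_def smult_sum_right smult_monom mult_ac)
qed

text \<open>The module law for the action through \<open>conn W\<close>. The potential X yields
  associativity of the product; the twisted potential yields multiplicativity of the twist.\<close>

lemma ev_ore_mult: "ev (conn W) (ore_mult A B) C = ev (conn W) A (ev (conn W) B C)"
  unfolding ore_mult_eq_ev
proof (induction A arbitrary: B)
  case (pCons a A)
  then show ?case
    by (simp add: ev_pCons ev_add_left ev_smult ev_dop)
qed simp

lemma ore_mult_assoc: "ore_mult (ore_mult A B) C = ore_mult A (ore_mult B C)"
  using ev_ore_mult[of "[:0, 1:]" A B C] by (simp add: ore_mult_eq_ev)

text \<open>The symbol 1 is a cyclic vector, since \<partial>^i sends it to X^i. An operator is thus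
  recovered from its action on 1.\<close>

lemma ev_dop_1 [simp]:
  fixes A :: "'k::field poly fract poly"
  shows "ev dop A 1 = A"
proof -
  have "(dop ^^ i) (1 :: 'k poly fract poly) = Polynomial.monom 1 i" for i
    by (induction i) (simp_all add: dop_monom)
  then show ?thesis
    by (simp add: ev_def smult_monom poly_as_sum_of_monoms)
qed

lemma ore_mult_distrib_right: "ore_mult (A + B) C = ore_mult A C + ore_mult B C"
  by (simp add: ore_mult_eq_ev ev_add_left)

lemma ore_mult_distrib_left: "ore_mult A (B + C) = ore_mult A B + ore_mult A C"
  by (simp add: ore_mult_eq_ev ev_conn_add)

lemma ore_mult_0_left [simp]: "ore_mult 0 A = 0"
  and ore_mult_0_right [simp]: "ore_mult A 0 = 0"
  and ore_mult_1_left [simp]: "ore_mult 1 A = A"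
  and ore_mult_1_right [simp]: "ore_mult A 1 = A"
  by (simp_all add: ore_mult_eq_ev)

lemma ore_mult_const:
  assumes "map_poly ddt H = 0"
  shows "ore_mult A (H * B) = H * ore_mult A B"
  using assms by (simp add: ore_mult_eq_ev ev_conn_mult_const)

subsection \<open>The p-curvature\<close>

lemma of_nat_power_CHAR:
  assumes "prime CHAR('a::comm_semiring_1)"
  shows "of_nat n ^ CHAR('a) = (of_nat n :: 'a)"
proof (induction n)
  case 0
  then show ?case
    using assms by (simp add: prime_gt_0_nat zero_power)
next
  case (Suc n)
  then show ?case
    using freshmans_dream[OF assms refl, of 1 "of_nat n"] by simp
qed

text \<open>By Fermat, Y^p - Y has the p distinct roots 0, ..., p - 1.\<close>

lemma prod_diff_of_nat:
  fixes y :: "'a::idom"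
  assumes "prime CHAR('a)"
  shows "(\<Prod>i<CHAR('a). y - of_nat i) = y ^ CHAR('a) - y"
proof -
  let ?p = "CHAR('a)"
  let ?P = "\<Prod>i<?p. [:- of_nat i, 1 :: 'a:]"
  let ?Q = "Polynomial.monom 1 ?p - Polynomial.monom (1 :: 'a) 1"
  have p: "?p \<ge> 2"
    using assms by (rule prime_ge_2_nat)
  have inj: "inj_on (of_nat :: nat \<Rightarrow> 'a) {..<?p}"
  proof (rule linorder_inj_onI)
    fix i j :: nat assume "i < j" "j \<in> {..<?p}"
    then have "(of_nat (j - i) :: 'a) \<noteq> 0"
      unfolding of_nat_eq_0_iff_char_dvd by (auto dest: dvd_imp_le)
    then show "(of_nat i :: 'a) \<noteq> of_nat j"
      using \<open>i < j\<close> by (metis diff_self less_imp_le of_nat_diff)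
  qed auto
  have "?P = ?Q"
  \<comment> \<open>Agreement at p points is enough for degree at most p because the coefficients in
    degree p also agree.\<close>
  proof (rule poly_eqI_degree_lead_coeff)
    show "degree ?P \<le> ?p"
      by (rule order.trans[OF degree_prod_sum_le]) auto
    show "degree ?Q \<le> ?p"
      using p by (intro degree_diff_le) (auto simp: degree_monom_eq)
    have "degree ?P = ?p"
      by (subst degree_prod_eq_sum_degree) auto
    then show "poly.coeff ?P ?p = poly.coeff ?Q ?p"
      using lead_coeff_prod[of "\<lambda>i. [:- of_nat i, 1 :: 'a:]" "{..<?p}"] p by simp
    show "card (of_nat ` {..<?p} :: 'a set) \<ge> ?p"
      using inj by (simp add: card_image)
    fix x :: 'a assume "x \<in> of_nat ` {..<?p}"
    then show "poly ?P x = poly ?Q x"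
      by (auto simp: poly_prod poly_monom of_nat_power_CHAR[OF assms])
  qed
  then have "poly ?P y = poly ?Q y"
    by simp
  then show ?thesis
    by (simp add: poly_prod poly_monom)
qed

section \<open>Polynomials in an operator, with coefficients that commute with it\<close>

definition opev :: "('a::comm_ring_1 \<Rightarrow> 'a) \<Rightarrow> 'a poly \<Rightarrow> 'a \<Rightarrow> 'a" where
  "opev T P C = (\<Sum>i\<le>degree P. poly.coeff P i * (T ^^ i) C)"

lemma opev_le: "degree P \<le> n \<Longrightarrow> opev T P C = (\<Sum>i\<le>n. poly.coeff P i * (T ^^ i) C)"
  unfolding opev_def by (rule sum.mono_neutral_left) (auto simp: coeff_eq_0)

lemma opev_add: "opev T (P + Q) C = opev T P C + opev T Q C"
  by (simp add: opev_le[OF degree_add_le_max] opev_le[of P "max (degree P) (degree Q)"]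
      opev_le[of Q "max (degree P) (degree Q)"] distrib_right sum.distrib)

lemma opev_smult: "opev T (Polynomial.smult h P) C = h * opev T P C"
  by (subst opev_le[OF degree_smult_le]) (simp add: opev_def sum_distrib_left mult_ac)

lemma opev_minus: "opev T (- P) C = - opev T P C"
  by (simp add: opev_def sum_negf)

lemma opev_diff: "opev T (P - Q) C = opev T P C - opev T Q C"
  using opev_add[of T P "- Q" C] by (simp add: opev_minus)

lemma opev_pCons: "opev T (pCons a P) C = a * C + opev T P (T C)"
proof -
  have "opev T (pCons a P) C = (\<Sum>i\<le>Suc (degree P). poly.coeff (pCons a P) i * (T ^^ i) C)"
    by (rule opev_le) (simp add: degree_pCons_le)
  also have "\<dots> = a * C + opev T P (T C)"
    by (simp add: opev_def sum.atMost_Suc_shift funpow_swap1 del: sum.atMost_Suc)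
  finally show ?thesis .
qed

lemma opev_monom: "opev T (Polynomial.monom 1 n) C = (T ^^ n) C"
  by (induction n arbitrary: C)
    (simp_all add: monom_0 monom_Suc opev_pCons opev_def[of T 0] funpow_swap1)

text \<open>Substituting \<open>T\<close> into polynomials is multiplicative only if the
  coefficients commute with \<open>T\<close>. \<open>S\<close> is a set of such scalars; for them,
  commutative identities such as Frobenius transfer to \<open>T\<close>.\<close>

locale linear_operator =
  fixes T :: "'a::comm_ring_1 \<Rightarrow> 'a" and S :: "'a set"
  assumes T_add: "T (x + y) = T x + T y"
    and T_scale: "s \<in> S \<Longrightarrow> T (s * x) = s * T x"
    and S_0: "0 \<in> S" and S_add: "s \<in> S \<Longrightarrow> s' \<in> S \<Longrightarrow> s + s' \<in> S"
    and S_mult: "s \<in> S \<Longrightarrow> s' \<in> S \<Longrightarrow> s * s' \<in> S" and S_1: "1 \<in> S"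
begin

lemma T_0: "T 0 = 0"
  using T_scale[OF S_0, of 0] by simp

lemma opev_commute:
  "(\<And>i. poly.coeff P i \<in> S) \<Longrightarrow> opev T P (T C) = T (opev T P C)"
proof (induction P arbitrary: C)
  case 0
  then show ?case by (simp add: opev_def T_0)
next
  case (pCons a P)
  from pCons.prems have "a \<in> S" "\<And>i. poly.coeff P i \<in> S"
    by (metis coeff_pCons_0, metis coeff_pCons_Suc)
  then show ?case
    by (simp add: opev_pCons T_add T_scale pCons.IH)
qed

lemma coeff_mult_linear_mem:
  assumes "\<And>i. poly.coeff P i \<in> S" "h \<in> S"
  shows "poly.coeff ([:h, 1:] * P) i \<in> S"
  using assms S_0 by (cases i) (auto intro!: S_add S_mult)

lemma opev_mult_linear:
  assumes "\<And>i. poly.coeff P i \<in> S"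
  shows "opev T ([:h, 1:] * P) C = T (opev T P C) + h * opev T P C"
  using assms by (simp add: opev_add opev_smult opev_pCons opev_commute)

lemma coeff_prod_linear_mem:
  fixes n :: nat
  assumes "\<And>j. j < n \<Longrightarrow> h j \<in> S"
  shows "poly.coeff (\<Prod>j<n. [:h j, 1:]) i \<in> S"
  using assms
proof (induction n arbitrary: i)
  case 0
  then show ?case
    using S_0 S_1 by (cases i) auto
next
  case (Suc n)
  then show ?case
    using coeff_mult_linear_mem[of "\<Prod>j<n. [:h j, 1:]" "h n" i]
    by (simp add: mult.commute del: mult_pCons_left mult_pCons_right)
qed

text \<open>The product of the factors T + h_j is described by the orbit \<open>F\<close> that it
  produces, so that \<open>F\<close> can be supplied in closed form, such as t^j E^j C.\<close>

lemma opev_prod_linear: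
  assumes "\<And>j. j < n \<Longrightarrow> h j \<in> S" and "F 0 = C"
    and "\<And>j. j < n \<Longrightarrow> F (Suc j) = T (F j) + h j * F j"
  shows "opev T (\<Prod>j<n. [:h j, 1:]) C = F n"
  using assms
proof (induction n)
  case 0
  then show ?case by (simp add: opev_def)
next
  case (Suc n)
  have "opev T ([:h n, 1:] * (\<Prod>j<n. [:h j, 1:])) C = F (Suc n)"
    by (subst opev_mult_linear) (use Suc in \<open>simp_all add: coeff_prod_linear_mem\<close>)
  then show ?case
    by (simp add: mult.commute del: mult_pCons_left mult_pCons_right)
qed

end

section \<open>p-th powers of connections, computed through the Euler operator\<close>

definition tvar :: "'k::field poly fract" where
  "tvar = Fraction_Field.Fract [:0, 1:] 1"

lemma tvar_nonzero [simp]: "tvar \<noteq> 0"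
  by (simp add: tvar_def Zero_fract_def eq_fract)

lemma ddt_tvar [simp]: "ddt tvar = 1"
  by (simp add: tvar_def ddt_Fract pderiv_pCons One_fract_def one_pCons)

lemma ddt_power: "ddt (x ^ n) = of_nat n * x ^ (n - 1) * ddt x"
proof (induction n)
  case (Suc n)
  then show ?case
    by (cases n) (simp_all add: ddt_mult algebra_simps)
qed simp

lemma map_poly_ddt_of_nat [simp]: "map_poly ddt (of_nat n) = 0"
  by (simp add: of_nat_poly map_poly_ddt_pCons)

lemma map_poly_ddt_1 [simp]: "map_poly ddt 1 = 0"
  using map_poly_ddt_of_nat[of 1] by simp

lemma map_poly_ddt_minus: "map_poly ddt (- A) = - map_poly ddt A"
  by (rule poly_eqI) (simp add: coeff_map_poly ddt_minus)

lemma linear_operator_ddt: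
  "linear_operator (map_poly ddt) {H :: 'k::field poly fract poly. map_poly ddt H = 0}"
  by unfold_locales (simp_all add: map_poly_ddt_add map_poly_ddt_mult)

lemma funpow_map_poly_ddt: "(map_poly ddt ^^ n) A = map_poly (ddt ^^ n) A"
proof (induction n)
  case (Suc n)
  then show ?case
    by (intro poly_eqI) (simp add: coeff_map_poly)
qed (simp add: map_poly_idI)

text \<open>Differentiating coefficients commutes with multiplication by X, so Frobenius splits the
  p-th power of their sum; the p-th derivative is zero.\<close>

lemma funpow_dop_CHAR:
  fixes C :: "'k::{field,finite} poly fract poly"
  shows "(dop ^^ CHAR('k)) C = Polynomial.monom 1 CHAR('k) * C"
proof -
  interpret linear_operator "map_poly ddt" "{H :: 'k poly fract poly. map_poly ddt H = 0}"
    by (rule linear_operator_ddt)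
  let ?p = "CHAR('k)" and ?X = "[:0, 1 :: 'k poly fract:]"
  have "(dop ^^ ?p) C = opev (map_poly ddt) (\<Prod>j<?p. [:?X, 1:]) C"
    by (rule opev_prod_linear[symmetric]) (simp_all add: map_poly_ddt_pCons conn_def)
  \<comment> \<open>The outer variable stands for \<open>map_poly ddt\<close>, the constant
    \<open>?X\<close> for multiplication by the variable of the symbol.\<close>
  also have "(\<Prod>j<?p. [:?X, 1:]) = ([:0, 1:] + [:?X:]) ^ ?p"
    by simp
  also have "\<dots> = [:0, 1:] ^ ?p + [:?X:] ^ ?p"
    by (rule freshmans_dream) (simp_all add: CHAR_fract CHAR_poly_idom prime_CHAR_finite)
  also have "\<dots> = Polynomial.monom 1 ?p + [:?X ^ ?p:]"
    by (simp add: monom_altdef poly_const_pow)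
  moreover have "(map_poly ddt ^^ ?p) C = 0"
    by (rule poly_eqI) (simp add: funpow_map_poly_ddt coeff_map_poly higher_ddt_CHAR)
  then have "opev (map_poly ddt) (Polynomial.monom 1 ?p + [:?X ^ ?p:]) C = ?X ^ ?p * C"
    by (simp add: opev_add opev_monom opev_pCons opev_def[of _ 0])
  ultimately show ?thesis
    by (simp add: monom_altdef)
qed

lemma linear_operator_Euler:
  "linear_operator (\<lambda>C. Polynomial.smult tvar (dop C)) {H :: 'k::field poly fract poly. map_poly ddt H = 0}"
  by unfold_locales (simp_all add: map_poly_ddt_add map_poly_ddt_mult conn_add conn_mult smult_add_right)

text \<open>Multiplication by t^p turns the p-th power into a falling factorial with p factors. In
  characteristic p this collapses to Y^p - Y at Y = T + H, and Frobenius separates the commuting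
  summands T and H.\<close>

lemma funpow_conn_CHAR_Euler:
  fixes C H :: "'k::{field,finite} poly fract poly"
  assumes "map_poly ddt H = 0"
  defines "T \<equiv> \<lambda>C. Polynomial.smult tvar (dop C)"
  shows "Polynomial.smult (tvar ^ CHAR('k)) ((conn ([:0, 1:] + Polynomial.smult (inverse tvar) H) ^^ CHAR('k)) C) =
    (T ^^ CHAR('k)) C - T C + (H ^ CHAR('k) - H) * C"
proof -
  interpret linear_operator T "{H :: 'k poly fract poly. map_poly ddt H = 0}"
    unfolding T_def by (rule linear_operator_Euler)
  let ?p = "CHAR('k)" and ?E = "conn ([:0, 1:] + Polynomial.smult (inverse tvar) H)"
  have tE: "Polynomial.smult tvar (?E D) = T D + H * D" for D
    by (simp add: T_def conn_def distrib_right smult_add_right)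
  \<comment> \<open>\<open>t\<^sup>n E\<^sup>n = (tE)(tE - 1) \<dots> (tE - n + 1)\<close>, and \<open>tE = T + H\<close>\<close>
  have "opev T (\<Prod>j<?p. [:H - of_nat j, 1:]) C = Polynomial.smult (tvar ^ ?p) ((?E ^^ ?p) C)"
  proof (rule opev_prod_linear)
    fix j
    let ?D = "(?E ^^ j) C"
    have "?E (Polynomial.smult (tvar ^ j) ?D) =
        Polynomial.smult (tvar ^ j) (?E ?D) + Polynomial.smult (of_nat j * tvar ^ (j - 1)) ?D"
      by (simp add: conn_smult ddt_power)
    then have "T (Polynomial.smult (tvar ^ j) ?D) + H * Polynomial.smult (tvar ^ j) ?D =
        Polynomial.smult (tvar ^ Suc j) (?E ?D) + Polynomial.smult (of_nat j * tvar ^ j) ?D"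
      unfolding tE[symmetric] by (cases j) (simp_all add: smult_add_right mult_ac)
    then show "Polynomial.smult (tvar ^ Suc j) ((?E ^^ Suc j) C) =
        T (Polynomial.smult (tvar ^ j) ?D) + (H - of_nat j) * Polynomial.smult (tvar ^ j) ?D"
      by (simp add: left_diff_distrib of_nat_poly smult_diff_right mult_ac eq_diff_eq add_diff_eq)
  qed (use assms(1) map_poly_ddt_add[of H "- of_nat _"] in \<open>simp_all add: map_poly_ddt_minus\<close>)
  moreover have "(\<Prod>j<?p. [:H - of_nat j, 1:]) = Polynomial.monom 1 ?p + [:H ^ ?p:] - [:H, 1:]"
  proof -
    have "(\<Prod>j<?p. [:H - of_nat j, 1:]) = (\<Prod>j<?p. [:H, 1:] - of_nat j)"
      by (simp add: of_nat_poly)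
    also have "\<dots> = [:H, 1:] ^ ?p - [:H, 1:]"
      using prod_diff_of_nat[of "[:H, 1:]"] by (simp add: CHAR_fract CHAR_poly_idom prime_CHAR_finite)
    also have "[:H, 1:] ^ ?p = ([:0, 1:] + [:H:]) ^ ?p"
      by simp
    also have "\<dots> = [:0, 1:] ^ ?p + [:H:] ^ ?p"
      by (rule freshmans_dream) (simp_all add: CHAR_fract CHAR_poly_idom prime_CHAR_finite)
    also have "\<dots> = Polynomial.monom 1 ?p + [:H ^ ?p:]"
      by (simp add: monom_altdef poly_const_pow)
    finally show ?thesis .
  qed
  ultimately have "Polynomial.smult (tvar ^ ?p) ((?E ^^ ?p) C) =
      opev T (Polynomial.monom 1 ?p + [:H ^ ?p:] - [:H, 1:]) C"
    by (simp only:)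
  also have "\<dots> = (T ^^ ?p) C - T C + (H ^ ?p - H) * C"
    by (simp add: opev_add opev_diff opev_monom opev_pCons opev_def[of _ 0] algebra_simps)
  finally show ?thesis .
qed

lemma funpow_conn_CHAR:
  fixes C H :: "'k::{field,finite} poly fract poly"
  assumes "map_poly ddt H = 0"
  shows "(conn ([:0, 1:] + Polynomial.smult (inverse tvar) H) ^^ CHAR('k)) C =
    (Polynomial.monom 1 CHAR('k) + Polynomial.smult (inverse (tvar ^ CHAR('k))) (H ^ CHAR('k) - H)) * C"
    (is "?L = (?M + Polynomial.smult _ ?K) * C")
proof -
  let ?p = "CHAR('k)"
  have p: "?p > 0"
    by (simp add: finite_imp_CHAR_pos)
  \<comment> \<open>Comparison with the instance \<open>H = 0\<close> eliminates the powers of the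
    Euler operator, since that instance is known from \<open>funpow_dop_CHAR\<close>.\<close>
  have "Polynomial.smult (tvar ^ ?p) ?L = Polynomial.smult (tvar ^ ?p) (?M * C) + ?K * C"
    using funpow_conn_CHAR_Euler[OF assms, of C] funpow_conn_CHAR_Euler[of 0 C] p
    by (simp add: funpow_dop_CHAR zero_power)
  then have "Polynomial.smult (inverse (tvar ^ ?p)) (Polynomial.smult (tvar ^ ?p) ?L) =
      Polynomial.smult (inverse (tvar ^ ?p)) (Polynomial.smult (tvar ^ ?p) (?M * C) + ?K * C)"
    by simp
  then show ?thesis
    by (simp add: smult_add_right distrib_right)
qed

subsection \<open>Polynomials over a subfield\<close>

locale coeff_field =
  fixes F :: "'a::field set"
  assumes F_0: "0 \<in> F" and F_1: "1 \<in> F"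
    and F_add: "x \<in> F \<Longrightarrow> y \<in> F \<Longrightarrow> x + y \<in> F"
    and F_minus: "x \<in> F \<Longrightarrow> - x \<in> F"
    and F_mult: "x \<in> F \<Longrightarrow> y \<in> F \<Longrightarrow> x * y \<in> F"
    and F_inverse: "x \<in> F \<Longrightarrow> inverse x \<in> F"
begin

lemma F_of_nat: "of_nat n \<in> F"
  by (induction n) (simp_all add: F_0 F_1 F_add)

lemma F_sum: "(\<And>i. i \<in> I \<Longrightarrow> f i \<in> F) \<Longrightarrow> sum f I \<in> F"
  by (induction I rule: infinite_finite_induct) (simp_all add: F_0 F_add)

lemma poly_over_0: "poly_over F 0"
  by (simp add: poly_over_def F_0)

lemma poly_over_pCons: "a \<in> F \<Longrightarrow> poly_over F A \<Longrightarrow> poly_over F (pCons a A)"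
  by (simp add: poly_over_def coeff_pCons split: nat.split)

lemma poly_over_1: "poly_over F 1"
  by (simp add: one_pCons poly_over_pCons poly_over_0 F_1)

lemma poly_over_add: "poly_over F A \<Longrightarrow> poly_over F B \<Longrightarrow> poly_over F (A + B)"
  by (simp add: poly_over_def F_add)

lemma poly_over_diff: "poly_over F A \<Longrightarrow> poly_over F B \<Longrightarrow> poly_over F (A - B)"
  unfolding poly_over_def coeff_diff by (metis F_add F_minus add_uminus_conv_diff)

lemma poly_over_mult: "poly_over F A \<Longrightarrow> poly_over F B \<Longrightarrow> poly_over F (A * B)"
  by (simp add: poly_over_def coeff_mult F_sum F_mult)

lemma poly_over_smult: "a \<in> F \<Longrightarrow> poly_over F A \<Longrightarrow> poly_over F (Polynomial.smult a A)"
  by (simp add: poly_over_def F_mult)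

lemma poly_over_power: "poly_over F A \<Longrightarrow> poly_over F (A ^ n)"
  by (induction n) (simp_all add: poly_over_1 poly_over_mult)

lemma poly_over_pderiv: "poly_over F A \<Longrightarrow> poly_over F (pderiv A)"
  unfolding poly_over_def coeff_pderiv by (metis F_mult F_of_nat)

lemma poly_over_pcompose:
  assumes "poly_over F A" "poly_over F B"
  shows "poly_over F (pcompose A B)"
  using assms(1)
proof (induction A)
  case (pCons a A)
  then have "a \<in> F" "poly_over F A"
    unfolding poly_over_def by (metis coeff_pCons_0, metis coeff_pCons_Suc)
  then show ?case
    using pCons.IH assms(2)
    by (simp add: pcompose_pCons poly_over_add poly_over_mult poly_over_pCons poly_over_0)
qed (simp add: poly_over_0)

text \<open>Long division stays over the subfield because each new coefficient of the quotient is a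
  ratio of leading coefficients.\<close>

lemma division:
  assumes "poly_over F A" "poly_over F D" "D \<noteq> 0"
  shows "\<exists>Q R. poly_over F Q \<and> poly_over F R \<and> A = D * Q + R \<and> (R = 0 \<or> degree R < degree D)"
  using assms(1)
proof (induction "degree A" arbitrary: A rule: less_induct)
  case less
  show ?case
  proof (cases "A = 0 \<or> degree A < degree D")
    case True
    then show ?thesis
      using less.prems poly_over_0 by (intro exI[of _ 0] exI[of _ A]) auto
  next
    case False
    define M where "M = Polynomial.monom (lead_coeff A * inverse (lead_coeff D)) (degree A - degree D)"
    have M: "poly_over F M"
      using less.prems assms(2) by (auto simp: M_def poly_over_def F_0 F_mult F_inverse)
    have "M \<noteq> 0"
      using False assms(3) by (simp add: M_def)
    have deg: "degree (D * M) = degree A"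
      using False assms(3) \<open>M \<noteq> 0\<close> by (simp add: degree_mult_eq) (simp add: M_def degree_monom_eq)
    have "lead_coeff (D * M) = lead_coeff A"
      unfolding lead_coeff_mult M_def lead_coeff_monom using assms(3) by simp
    then have "poly.coeff (D * M) (degree A) = lead_coeff A"
      by (simp only: deg)
    then have drop: "A - D * M = 0 \<or> degree (A - D * M) < degree A"
      using deg by (intro eq_zero_or_degree_less degree_diff_le) auto
    have over: "poly_over F (A - D * M)"
      by (intro poly_over_diff poly_over_mult less.prems assms M)
    have "\<exists>Q R. poly_over F Q \<and> poly_over F R \<and> A - D * M = D * Q + R \<and> (R = 0 \<or> degree R < degree D)"
    proof (cases "A - D * M = 0")
      case True
      then show ?thesis
        using poly_over_0 by (intro exI[of _ 0]) simp
    qed (use drop less.hyps over in blast)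
    then obtain Q R where QR: "poly_over F Q" "poly_over F R" "A - D * M = D * Q + R"
        "R = 0 \<or> degree R < degree D"
      by blast
    then have "A = D * (Q + M) + R"
      by (simp add: algebra_simps)
    then show ?thesis
      using QR M poly_over_add by blast
  qed
qed

text \<open>In the ideal generated by N and N' over \<open>F\<close>, an element of least degree
  divides both generators by \<open>division\<close>, hence is constant by separability.\<close>

lemma separable_bezout:
  assumes "separable_over F N" "N \<noteq> 0"
  shows "\<exists>w u. poly_over F w \<and> poly_over F u \<and> w * pderiv N + u * N = 1"
proof -
  have N: "poly_over F N" "poly_over F (pderiv N)"
    using assms(1) by (simp_all add: separable_over_def poly_over_pderiv)
  define I where "I = {w * pderiv N + u * N | w u. poly_over F w \<and> poly_over F u}"
  have I_over: "poly_over F A" if "A \<in> I" for A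
    using that N by (auto simp: I_def intro!: poly_over_add poly_over_mult)
  have I_diff: "A - D * Q \<in> I" if AD: "A \<in> I" "D \<in> I" and Q: "poly_over F Q" for A D Q
  proof -
    from AD obtain w u w' u' where "poly_over F w" "poly_over F u" "poly_over F w'" "poly_over F u'"
      and "A = w * pderiv N + u * N" "D = w' * pderiv N + u' * N"
      unfolding I_def by blast
    moreover from this have "A - D * Q = (w - w' * Q) * pderiv N + (u - u' * Q) * N"
      by (simp add: algebra_simps)
    ultimately show ?thesis
      unfolding I_def using Q poly_over_diff poly_over_mult by blast
  qed
  have "0 * pderiv N + 1 * N \<in> I" "1 * pderiv N + 0 * N \<in> I"
    unfolding I_def using poly_over_0 poly_over_1 by blast+
  then have NI: "N \<in> I" "pderiv N \<in> I"
    by simp_all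
  then obtain D where D: "D \<in> I" "D \<noteq> 0"
    and least: "\<And>A. A \<in> I \<Longrightarrow> A \<noteq> 0 \<Longrightarrow> degree D \<le> degree A"
    using ex_has_least_nat[of "\<lambda>A. A \<in> I \<and> A \<noteq> 0" N degree] assms(2) by blast
  have dvd: "D dvd A" if A: "A \<in> I" for A
  proof -
    obtain Q R where QR: "poly_over F Q" "A = D * Q + R" "R = 0 \<or> degree R < degree D"
      using division[OF I_over[OF A] I_over[OF D(1)] D(2)] by blast
    have "R = A - D * Q"
      using QR(2) by simp
    then have "R \<in> I"
      using I_diff[OF A D(1) QR(1)] by simp
    then have "R = 0"
      using QR(3) least[of R] by force
    then show ?thesis
      using QR(2) by simp
  qed
  have "degree D = 0"
    using assms(1) I_over[OF D(1)] dvd NI unfolding separable_over_def by blast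
  then obtain d where d: "D = [:d:]"
    by (rule degree_eq_zeroE)
  with D(2) have "d \<noteq> 0"
    by simp
  have "d \<in> F"
    using I_over[OF D(1)] d unfolding poly_over_def by (metis coeff_pCons_0)
  obtain w u where wu: "poly_over F w" "poly_over F u" "D = w * pderiv N + u * N"
    using D(1) unfolding I_def by blast
  have "1 = Polynomial.smult (inverse d) D"
    using d \<open>d \<noteq> 0\<close> by (simp add: one_pCons)
  also have "\<dots> = Polynomial.smult (inverse d) w * pderiv N + Polynomial.smult (inverse d) u * N"
    by (simp add: wu(3) smult_add_right)
  finally show ?thesis
    using wu(1,2) \<open>d \<in> F\<close>
    by (intro exI[of _ "Polynomial.smult (inverse d) w"] exI[of _ "Polynomial.smult (inverse d) u"])
      (simp add: poly_over_smult F_inverse)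
qed

end

section \<open>Taylor expansion and Hensel lifting\<close>

lemma dvd_pcompose_diff: "(x - y) dvd (pcompose A x - pcompose A (y :: 'a::comm_ring_1 poly))"
proof (induction A)
  case (pCons a A)
  have "pcompose (pCons a A) x - pcompose (pCons a A) y =
      x * (pcompose A x - pcompose A y) + (x - y) * pcompose A y"
    by (simp add: pcompose_pCons algebra_simps)
  then show ?case
    using pCons.IH by simp
qed simp

text \<open>Stating the remainder as a divisibility avoids division by factorials, so it is valid in
  characteristic p.\<close>

lemma pcompose_taylor:
  "d\<^sup>2 dvd (pcompose A (z + d) - pcompose A z - d * pcompose (pderiv A) (z :: 'a::idom poly))"
proof (induction A)
  case (pCons a A)
  have "pcompose (pCons a A) (z + d) - pcompose (pCons a A) z - d * pcompose (pderiv (pCons a A)) z =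
      (z + d) * (pcompose A (z + d) - pcompose A z - d * pcompose (pderiv A) z) +
      d\<^sup>2 * pcompose (pderiv A) z"
    by (simp add: pcompose_pCons pderiv_pCons pcompose_add power2_eq_square algebra_simps)
  then show ?case
    using pCons.IH by simp
qed simp

text \<open>The map g |-> (g^p - g)/c is additive, so corrections can simply be added to
  \<open>g\<close>, and its linear part -g/c is invertible. The condition \<open>N dvd g\<close>
  keeps the argument congruent to Y modulo N, where the Bezout identity applies.\<close>

lemma (in coeff_field) hensel_artin_schreier:
  assumes p: "prime CHAR('a)"
    and N: "poly_over F N" and w: "poly_over F w" and bezout: "w * pderiv N + u * N = 1"
    and c: "c \<in> F" "c \<noteq> 0" and k: "k \<ge> 1"
  shows "\<exists>g. poly_over F g \<and> N dvd g \<and>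
    N ^ k dvd pcompose N ([:0, 1:] + Polynomial.smult (inverse c) (g ^ CHAR('a) - g))"
  using k
proof (induction k rule: dec_induct)
  case base
  have "poly_over F 0 \<and> N dvd 0 \<and>
      N ^ 1 dvd pcompose N ([:0, 1:] + Polynomial.smult (inverse c) (0 ^ CHAR('a) - 0))"
    using prime_gt_0_nat[OF p] by (simp add: zero_power poly_over_0)
  then show ?case
    by blast
next
  case (step k)
  let ?p = "CHAR('a)" and ?Y = "[:0, 1 :: 'a:]" and ?c = "inverse c"
  obtain g where g: "poly_over F g" "N dvd g"
    "N ^ k dvd pcompose N (?Y + Polynomial.smult ?c (g ^ ?p - g))"
    using step.IH by blast
  define z where "z = ?Y + Polynomial.smult ?c (g ^ ?p - g)"
  define v where "v = pcompose N z"
  define h where "h = Polynomial.smult c (w * v)"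
  define d where "d = Polynomial.smult ?c (h ^ ?p - h)"
  \<comment> \<open>Newton step: modulo \<open>N\<^sup>k\<^sup>+\<^sup>1\<close> the \<open>p\<close>-th power of \<open>h\<close> vanishes, so \<open>d\<close> is \<open>- w v\<close>, and \<open>w\<close> inverts the derivative modulo \<open>N\<close>.\<close>
  have Nv: "N ^ k dvd v"
    using g(3) by (simp add: v_def z_def)
  then have Nh: "N ^ k dvd h"
    by (simp add: h_def dvd_smult)
  have "N dvd N ^ k"
    using step.hyps by (simp add: dvd_power)
  have z_over: "poly_over F z"
    unfolding z_def
    by (intro poly_over_add poly_over_smult poly_over_diff poly_over_power F_inverse c g poly_over_pCons
        poly_over_0 F_0 F_1)
  have "poly_over F (g + h)"
    unfolding h_def v_def by (intro poly_over_add poly_over_smult poly_over_mult poly_over_pcompose g w c N z_over)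
  moreover have "N dvd g + h"
    by (rule dvd_add[OF g(2) dvd_trans[OF \<open>N dvd N ^ k\<close> Nh]])
  moreover have "N ^ Suc k dvd pcompose N (z + d)"
  proof -
    \<comment> \<open>Squares of multiples of N^k vanish modulo N^(k+1) because \<open>k\<close> is
      at least 1. This disposes of the Taylor remainder and, as p is at least 2, of h^p.\<close>
    have "k * 2 \<ge> Suc k"
      using step.hyps by simp
    have sq: "N ^ Suc k dvd x\<^sup>2" if "N ^ k dvd x" for x
      by (rule dvd_trans[OF le_imp_power_dvd[OF \<open>k * 2 \<ge> Suc k\<close>]
            dvd_power_same[OF that, of 2, folded power_mult]])
    have hp: "N ^ Suc k dvd h ^ ?p"
      by (rule dvd_trans[OF sq[OF Nh] le_imp_power_dvd[OF prime_ge_2_nat[OF p]]])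
    then have "N ^ k dvd h ^ ?p"
      by (rule dvd_trans[OF le_imp_power_dvd, rotated]) simp
    then have "N ^ k dvd d"
      using Nh by (simp add: d_def dvd_smult)
    then have 1: "N ^ Suc k dvd pcompose N (z + d) - v - d * pcompose (pderiv N) z"
      unfolding v_def by (rule dvd_trans[OF sq pcompose_taylor])
    have "z - ?Y = Polynomial.smult ?c (g ^ ?p - g)"
      by (simp add: z_def)
    moreover have "N dvd g ^ ?p"
      by (rule dvd_trans[OF g(2) dvd_power]) (simp add: prime_gt_0_nat[OF p])
    ultimately have "N dvd z - ?Y"
      using g(2) by (simp add: dvd_smult)
    then have "N dvd pcompose (pderiv N) z - pderiv N"
      using dvd_trans[OF _ dvd_pcompose_diff[of z ?Y "pderiv N"]] by simp
    then have "N dvd u * N - w * (pcompose (pderiv N) z - pderiv N)"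
      by simp
    also have "u * N - w * (pcompose (pderiv N) z - pderiv N) = 1 - w * pcompose (pderiv N) z"
      unfolding bezout[symmetric] by (simp add: algebra_simps)
    finally have 2: "N ^ Suc k dvd v * (1 - w * pcompose (pderiv N) z)"
      using Nv by (simp add: mult_dvd_mono mult.commute[of N])
    have "d = Polynomial.smult ?c (h ^ ?p) - w * v"
      using c(2) by (simp add: d_def h_def smult_diff_right)
    then have "d * pcompose (pderiv N) z =
        Polynomial.smult ?c (h ^ ?p) * pcompose (pderiv N) z - w * v * pcompose (pderiv N) z"
      by (simp only: left_diff_distrib)
    then have 3: "pcompose N (z + d) = (pcompose N (z + d) - v - d * pcompose (pderiv N) z) +
        v * (1 - w * pcompose (pderiv N) z) + Polynomial.smult ?c (h ^ ?p) * pcompose (pderiv N) z"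
      by (simp add: algebra_simps)
    have 4: "N ^ Suc k dvd Polynomial.smult ?c (h ^ ?p) * pcompose (pderiv N) z"
      using hp by (simp add: dvd_smult)
    show ?thesis
      by (subst 3) (intro dvd_add 1 2 4)
  qed
  \<comment> \<open>Frobenius merges the old solution and the correction into one expression in
    \<open>g + h\<close>.\<close>
  moreover have "z + d = ?Y + Polynomial.smult ?c ((g + h) ^ ?p - (g + h))"
  proof -
    have "(g + h) ^ ?p = g ^ ?p + h ^ ?p"
      by (rule freshmans_dream) (simp_all add: CHAR_poly_idom p)
    then show ?thesis
      by (simp add: z_def d_def smult_add_right smult_diff_right)
  qed
  ultimately show ?case
    by metis
qed

subsection \<open>The field of constants\<close>

lemma pcompose_CHAR_nonzero:
  "b \<noteq> 0 \<Longrightarrow> pcompose b (Polynomial.monom 1 CHAR('k)) \<noteq> (0 :: 'k::{field,finite} poly)"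
  by (subst pcompose_eq_0_iff) (simp_all add: degree_monom_eq finite_imp_CHAR_pos)

lemma FtpE:
  assumes "x \<in> Ftp"
  obtains a b :: "'k::{field,finite} poly" where "b \<noteq> 0"
    "x = Fraction_Field.Fract (pcompose a (Polynomial.monom 1 CHAR('k))) (pcompose b (Polynomial.monom 1 CHAR('k)))"
  using assms unfolding Ftp_def by blast

lemma FtpI:
  fixes a b :: "'k::{field,finite} poly"
  assumes "x = Fraction_Field.Fract (pcompose a (Polynomial.monom 1 CHAR('k))) (pcompose b (Polynomial.monom 1 CHAR('k)))" "b \<noteq> 0"
  shows "x \<in> Ftp"
  using assms unfolding Ftp_def by blast

interpretation Ftp: coeff_field "Ftp :: 'k::{field,finite} poly fract set"
proof
  show "(0 :: 'k poly fract) \<in> Ftp"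
    by (rule FtpI[of _ 0 1]) (simp_all add: Zero_fract_def pcompose_1)
  show "(1 :: 'k poly fract) \<in> Ftp"
    by (rule FtpI[of _ 1 1]) (simp_all add: One_fract_def pcompose_1)
next
  fix x y :: "'k poly fract"
  assume "x \<in> Ftp" "y \<in> Ftp"
  then obtain a b c d :: "'k poly" where bd: "b \<noteq> 0" "d \<noteq> 0"
    and xy: "x = Fraction_Field.Fract (pcompose a (Polynomial.monom 1 CHAR('k))) (pcompose b (Polynomial.monom 1 CHAR('k)))"
    "y = Fraction_Field.Fract (pcompose c (Polynomial.monom 1 CHAR('k))) (pcompose d (Polynomial.monom 1 CHAR('k)))"
    by (elim FtpE)
  then show "x + y \<in> Ftp"
    by (intro FtpI[of _ "a * d + c * b" "b * d"])
      (simp_all add: pcompose_add pcompose_mult pcompose_CHAR_nonzero)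
  show "x * y \<in> Ftp"
    using bd xy by (intro FtpI[of _ "a * c" "b * d"]) (simp_all add: pcompose_mult)
next
  fix x :: "'k poly fract"
  assume "x \<in> Ftp"
  then obtain a b :: "'k poly" where b: "b \<noteq> 0"
    and x: "x = Fraction_Field.Fract (pcompose a (Polynomial.monom 1 CHAR('k))) (pcompose b (Polynomial.monom 1 CHAR('k)))"
    by (elim FtpE)
  show "- x \<in> Ftp"
    using b x by (auto intro!: FtpI[of _ "- a" b] simp: pcompose_uminus)
  show "inverse x \<in> Ftp"
  proof (cases "a = 0")
    case True
    then show ?thesis
      using x \<open>x \<in> Ftp\<close> by (simp add: fract_collapse)
  next
    case False
    then show ?thesis
      using x by (intro FtpI[of _ b a]) simp_all
  qed
qed

lemma ddt_Ftp: "x \<in> Ftp \<Longrightarrow> ddt x = (0 :: 'k::{field,finite} poly fract)"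
proof (erule FtpE)
  fix a b :: "'k poly"
  assume b: "b \<noteq> 0"
    "x = Fraction_Field.Fract (pcompose a (Polynomial.monom 1 CHAR('k))) (pcompose b (Polynomial.monom 1 CHAR('k)))"
  then show "ddt x = 0"
    by (simp add: ddt_Fract pcompose_CHAR_nonzero pderiv_pcompose pderiv_monom fract_collapse)
qed

text \<open>t^p plays the role of \<open>c\<close> in the Hensel lift; being in the subfield, it
  lets the solution have coefficients there.\<close>

lemma tvar_power_CHAR_Ftp: "tvar ^ CHAR('k) \<in> (Ftp :: 'k::{field,finite} poly fract set)"
proof (rule FtpI[of _ "[:0, 1:]" 1])
  have "tvar ^ n = Fraction_Field.Fract ([:0, 1 :: 'k:] ^ n) 1" for n
    by (induction n) (simp_all add: tvar_def One_fract_def)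
  then show "tvar ^ CHAR('k) = Fraction_Field.Fract (pcompose [:0, 1:] (Polynomial.monom 1 CHAR('k)))
      (pcompose (1 :: 'k poly) (Polynomial.monom 1 CHAR('k)))"
    by (simp add: pcompose_pCons pcompose_1 monom_altdef)
qed simp

subsection \<open>Central elements and a twisted endomorphism\<close>

lemma at_dp_eq_pcompose: "at_dp P = pcompose P (Polynomial.monom 1 CHAR('k))"
  for P :: "'k::{field,finite} poly fract poly"
proof -
  have "degree (map_poly (\<lambda>x. [:x:]) P) = degree P"
    by (rule degree_map_poly) simp
  then show ?thesis
    by (simp add: at_dp_def pcompose_altdef poly_altdef coeff_map_poly monom_power smult_monom)
qed

lemma map_poly_ddt_at_dp:
  fixes P :: "'k::{field,finite} poly fract poly"
  assumes "poly_over Ftp P"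
  shows "map_poly ddt (at_dp P) = 0"
  using assms
proof (induction P)
  case (pCons a P)
  then have "a \<in> Ftp" "poly_over Ftp P"
    unfolding poly_over_def by (metis coeff_pCons_0, metis coeff_pCons_Suc)
  then show ?case
    using pCons.IH
    by (simp add: at_dp_eq_pcompose pcompose_pCons map_poly_ddt_add map_poly_ddt_mult
        map_poly_ddt_pCons ddt_Ftp map_poly_monom)
qed (simp add: at_dp_eq_pcompose)

lemma ev_monom_mult: "ev E (Polynomial.monom 1 n * B) C = ev E B ((E ^^ n) C)"
proof (induction n arbitrary: C)
  case (Suc n)
  then show ?case
    by (simp add: monom_Suc ev_pCons funpow_swap1)
qed (simp add: monom_0)

text \<open>Serves twice: with Z = X^p for \<open>dop\<close>, and with the shifted value of
  \<open>funpow_conn_CHAR\<close> for the twisted connection.\<close>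

lemma ev_pcompose_monom:
  assumes "\<And>C. (E ^^ n) C = Z * C"
  shows "ev E (pcompose A (Polynomial.monom 1 n)) C = pcompose A Z * C"
proof (induction A arbitrary: C)
  case (pCons a A)
  then show ?case
    by (simp add: pcompose_pCons ev_add_left ev_pCons ev_monom_mult assms distrib_right mult.assoc mult.left_commute)
qed simp

lemma ore_mult_at_dp: "ore_mult (at_dp P) B = at_dp P * B"
  unfolding at_dp_eq_pcompose ore_mult_eq_ev
  by (rule ev_pcompose_monom) (rule funpow_dop_CHAR)

text \<open>The endomorphism fixing rational functions and sending the derivation \<open>\<partial>\<close> to \<open>\<partial> + H / t\<close>.\<close>
definition twist :: "'k::field poly fract poly \<Rightarrow> 'k poly fract poly \<Rightarrow> 'k poly fract poly" where
  "twist H A = ev (conn ([:0, 1:] + Polynomial.smult (inverse tvar) H)) A 1"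

lemma twist_add: "twist H (A + B) = twist H A + twist H B"
  by (simp add: twist_def ev_add_left)

lemma twist_1: "twist H 1 = 1"
  by (simp add: twist_def)

text \<open>Under the assumption on \<open>H\<close>, the twisted connection is left multiplication
  by \<partial> + H/t, and by associativity it commutes with right multiplications.\<close>

lemma ev_dop_twist:
  assumes "\<And>B. ore_mult H B = H * B"
  shows "ev dop (ev (conn ([:0, 1:] + Polynomial.smult (inverse tvar) H)) A B) C =
    ev (conn ([:0, 1:] + Polynomial.smult (inverse tvar) H)) A (ev dop B C)"
proof (induction A arbitrary: B)
  case (pCons a A)
  let ?E = "conn ([:0, 1:] + Polynomial.smult (inverse tvar) H)"
  have E: "?E B = dop B + Polynomial.smult (inverse tvar) (ore_mult H B)" for B
    by (simp add: assms conn_def distrib_right)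
  have "ev dop (?E B) C = ?E (ev dop B C)"
    by (simp only: E ev_add_left ev_smult ev_dop)
      (simp only: ore_mult_eq_ev[symmetric] ore_mult_assoc)
  then show ?case
    by (simp add: ev_pCons ev_add_left ev_smult pCons.IH)
qed simp

lemma twist_ore_mult:
  assumes "\<And>B. ore_mult H B = H * B"
  shows "twist H (ore_mult A B) = ore_mult (twist H A) (twist H B)"
proof -
  have "ore_mult (twist H A) C = ev (conn ([:0, 1:] + Polynomial.smult (inverse tvar) H)) A C" for C
    by (simp only: ore_mult_eq_ev twist_def ev_dop_twist[OF assms] ev_1)
  then show ?thesis
    by (simp add: twist_def ev_ore_mult)
qed

text \<open>Modulo M the two connections agree because M divides H, and they preserve multiples of M
  because M has zero derivative. Two starting points are compared so that the induction can pass to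
  their images.\<close>

lemma dvd_ev_twist_diff:
  assumes "M dvd H" "map_poly ddt M = 0" "M dvd D - C"
  shows "M dvd ev (conn ([:0, 1:] + Polynomial.smult (inverse tvar) H)) A D - ev dop A C"
  using assms(3)
proof (induction A arbitrary: C D)
  case (pCons a A)
  let ?E = "conn ([:0, 1:] + Polynomial.smult (inverse tvar) H)"
  obtain K where K: "D = C + M * K"
    using pCons.prems by (metis dvdE diff_eq_eq add.commute)
  have "?E D - dop C = M * dop K + Polynomial.smult (inverse tvar) (H * D)"
    by (simp add: K conn_def map_poly_ddt_add map_poly_ddt_mult assms(2) smult_add_right algebra_simps)
  then have "M dvd ?E D - dop C"
    using assms(1) by (simp add: dvd_smult)
  moreover have "ev ?E (pCons a A) D - ev dop (pCons a A) C =
      Polynomial.smult a (D - C) + (ev ?E A (?E D) - ev dop A (dop C))"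
    by (simp add: ev_pCons smult_diff_right)
  ultimately show ?case
    using pCons.IH pCons.prems by (simp only: dvd_add dvd_smult)
qed simp

lemma dvd_twist_diff:
  assumes "M dvd H" "map_poly ddt M = 0"
  shows "M dvd twist H A - A"
  using dvd_ev_twist_diff[OF assms, of 1 1 A] by (simp add: twist_def)

lemma twist_at_dp_mult:
  fixes H :: "'k::{field,finite} poly fract poly"
  assumes "map_poly ddt H = 0"
  shows "twist H (at_dp P * A) =
    pcompose P (Polynomial.monom 1 CHAR('k) +
      Polynomial.smult (inverse (tvar ^ CHAR('k))) (H ^ CHAR('k) - H)) * twist H A"
proof -
  have "twist H (at_dp P * A) = twist H (ore_mult (at_dp P) A)"
    by (simp only: ore_mult_at_dp)
  also have "\<dots> = pcompose P (Polynomial.monom 1 CHAR('k) +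
      Polynomial.smult (inverse (tvar ^ CHAR('k))) (H ^ CHAR('k) - H)) * twist H A"
    unfolding twist_def ev_ore_mult at_dp_eq_pcompose
    by (rule ev_pcompose_monom[OF funpow_conn_CHAR[OF assms]])
  finally show ?thesis .
qed

lemma at_dp_add: "at_dp (A + B) = at_dp A + at_dp B"
  by (simp add: at_dp_eq_pcompose pcompose_add)

lemma at_dp_diff: "at_dp (A - B) = at_dp A - at_dp B"
  by (simp add: at_dp_eq_pcompose pcompose_diff)

lemma at_dp_mult: "at_dp (A * B) = at_dp A * at_dp B"
  by (simp add: at_dp_eq_pcompose pcompose_mult)

lemma at_dp_1: "at_dp 1 = 1"
  by (simp add: at_dp_eq_pcompose pcompose_1)

lemma at_dp_power: "at_dp (A ^ n) = at_dp A ^ n"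
  by (induction n) (simp_all add: at_dp_1 at_dp_mult)

lemma at_dp_smult: "at_dp (Polynomial.smult a A) = Polynomial.smult a (at_dp A)"
  by (simp add: at_dp_eq_pcompose pcompose_smult)

lemma at_dp_pcompose: "at_dp (pcompose A B) = pcompose A (at_dp B)"
  by (simp add: at_dp_eq_pcompose pcompose_assoc)

lemma at_dp_dvd: "A dvd B \<Longrightarrow> at_dp A dvd at_dp B"
  by (metis at_dp_mult dvd_def)

text \<open>The last two properties say that \<Phi> descends to a map from the quotient by
  N(\<partial>^p) to the quotient by its \<nu>-th power, and that this map is a section of the
  projection.\<close>

lemma exists_splitting:
  fixes N :: "'k::{field,finite} poly fract poly"
  assumes "separable_over Ftp N" "N \<noteq> 0" "\<nu> \<ge> 1"
  shows "\<exists>\<Phi>. (\<forall>A B. \<Phi> (A + B) = \<Phi> A + \<Phi> B) \<and> \<Phi> 1 = 1 \<and>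
    (\<forall>A B. \<Phi> (ore_mult A B) = ore_mult (\<Phi> A) (\<Phi> B)) \<and>
    (\<forall>A. at_dp N dvd \<Phi> A - A) \<and> (\<forall>A. at_dp N dvd A \<longrightarrow> at_dp N ^ \<nu> dvd \<Phi> A)"
proof -
  let ?c = "tvar ^ CHAR('k) :: 'k poly fract"
  have N: "poly_over Ftp N"
    using assms(1) by (simp add: separable_over_def)
  obtain w u where wu: "poly_over Ftp w" "w * pderiv N + u * N = 1"
    using Ftp.separable_bezout[OF assms(1,2)] by blast
  have "\<exists>g. poly_over Ftp g \<and> N dvd g \<and> N ^ \<nu> dvd pcompose N
      ([:0, 1:] + Polynomial.smult (inverse ?c) (g ^ CHAR('k poly fract) - g))"
    by (rule Ftp.hensel_artin_schreier[OF _ N wu tvar_power_CHAR_Ftp _ assms(3)]) simp_all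
  then obtain g where g: "poly_over Ftp g" "N dvd g"
    "N ^ \<nu> dvd pcompose N ([:0, 1:] + Polynomial.smult (inverse ?c) (g ^ CHAR('k) - g))"
    unfolding CHAR_fract CHAR_poly_idom by blast
  let ?H = "at_dp g"
  have H: "map_poly ddt ?H = 0" "\<And>B. ore_mult ?H B = ?H * B"
    by (simp_all add: map_poly_ddt_at_dp g(1) ore_mult_at_dp)
  have "at_dp N ^ \<nu> dvd twist ?H A" if A: "at_dp N dvd A" for A
  proof -
    obtain B where B: "A = at_dp N * B"
      using A by (rule dvdE)
    \<comment> \<open>Under \<open>at_dp\<close> the argument of the Hensel lift becomes the image
      of \<partial>^p under the twist by \<open>at_dp g\<close>.\<close>
    have "Polynomial.monom 1 CHAR('k) + Polynomial.smult (inverse ?c) (?H ^ CHAR('k) - ?H) =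
        at_dp ([:0, 1:] + Polynomial.smult (inverse ?c) (g ^ CHAR('k) - g))"
      by (simp add: at_dp_add at_dp_smult at_dp_diff at_dp_power at_dp_eq_pcompose[of "[:0, 1:]"] pcompose_pCons)
    then have "twist ?H A =
        at_dp (pcompose N ([:0, 1:] + Polynomial.smult (inverse ?c) (g ^ CHAR('k) - g))) * twist ?H B"
      unfolding B twist_at_dp_mult[OF H(1)] at_dp_pcompose by (simp only:)
    then show ?thesis
      using at_dp_dvd[OF g(3)] by (simp add: at_dp_power)
  qed
  then show ?thesis
    using twist_ore_mult[OF H(2)] dvd_twist_diff[OF at_dp_dvd[OF g(2)] map_poly_ddt_at_dp[OF N]]
    by (intro exI[of _ "twist ?H"]) (simp add: twist_add twist_1)
qed

subsection \<open>Quotients by central operators\<close>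

lemma OreRing_simps [simp]:
  "carrier OreRing = UNIV" "mult OreRing = ore_mult" "one OreRing = 1"
  "zero OreRing = 0" "add OreRing = (+)"
  by (simp_all add: OreRing_def)

lemma ring_OreRing: "ring (OreRing :: 'k::field poly fract poly ring)"
proof (rule ringI)
  show "abelian_group (OreRing :: 'k poly fract poly ring)"
  proof (rule abelian_groupI)
    fix x :: "'k poly fract poly"
    show "\<exists>y\<in>carrier OreRing. y \<oplus>\<^bsub>OreRing\<^esub> x = \<zero>\<^bsub>OreRing\<^esub>"
      by (rule bexI[of _ "- x"]) simp_all
  qed (simp_all add: add_ac)
  show "Group.monoid (OreRing :: 'k poly fract poly ring)"
    by (rule monoidI) (simp_all add: ore_mult_assoc)
qed (simp_all add: ore_mult_distrib_left ore_mult_distrib_right)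

text \<open>Makes the Ore product with \<open>L\<close> an ordinary product of symbols on both
  sides: \<open>left\<close> gives one side, the vanishing derivative the other.\<close>

locale central_operator =
  fixes L :: "'k::field poly fract poly"
  assumes const: "map_poly ddt L = 0" and left: "ore_mult L B = L * B"
begin

lemma ore_mult_left: "ore_mult (L * A) B = L * ore_mult A B"
  by (simp add: left[symmetric] ore_mult_assoc)

lemma ore_mult_right: "ore_mult A (L * B) = L * ore_mult A B"
  by (rule ore_mult_const[OF const])

lemma left_ideal_gen_eq: "left_ideal_gen L = {B. L dvd B}"
  using ore_mult_right[of _ 1] by (auto simp: left_ideal_gen_def elim!: dvdE)

lemma ideal: "ideal (left_ideal_gen L) OreRing"
proof (rule idealI[OF ring_OreRing])
  show "subgroup (left_ideal_gen L) (add_monoid OreRing)"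
  proof
    fix x assume x: "x \<in> left_ideal_gen L"
    have "inv\<^bsub>add_monoid OreRing\<^esub> x = - x"
      by (rule group.inv_equality)
        (use abelian_group.a_group[OF ring.is_abelian_group[OF ring_OreRing]] in simp_all)
    then show "inv\<^bsub>add_monoid OreRing\<^esub> x \<in> left_ideal_gen L"
      using x by (simp add: left_ideal_gen_eq)
  qed (simp_all add: left_ideal_gen_eq)
qed (auto simp: left_ideal_gen_eq ore_mult_left ore_mult_right elim!: dvdE)

definition cls :: "'k poly fract poly \<Rightarrow> 'k poly fract poly set" where
  "cls A = left_ideal_gen L +>\<^bsub>OreRing\<^esub> A"

lemma cls_eq: "cls A = {B. L dvd B - A}"
proof -
  have "B \<in> cls A \<longleftrightarrow> L dvd B - A" for B
    by (auto simp: cls_def a_r_coset_def' left_ideal_gen_eq intro!: exI[of _ "B - A"])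
  then show ?thesis
    by blast
qed

lemma cls_eq_iff: "cls A = cls B \<longleftrightarrow> L dvd A - B"
proof
  assume "cls A = cls B"
  moreover have "A \<in> cls A"
    by (simp add: cls_eq)
  ultimately have "A \<in> cls B"
    by (simp only:)
  then show "L dvd A - B"
    by (simp add: cls_eq)
next
  assume AB: "L dvd A - B"
  have "L dvd C - A \<longleftrightarrow> L dvd C - B" for C
    using dvd_add_left_iff[OF AB, of "C - A"] by simp
  then show "cls A = cls B"
    by (simp add: cls_eq)
qed

lemma ring_Dquot: "ring (Dquot L)"
  unfolding Dquot_def by (rule ideal.quotient_is_ring[OF ideal])

lemma carrier_Dquot: "carrier (Dquot L) = range cls"
  by (simp add: Dquot_def FactRing_def A_RCOSETS_def' cls_def UNION_singleton_eq_range)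

lemma cls_mem [simp]: "cls A \<in> carrier (Dquot L)"
  by (simp add: carrier_Dquot)

lemma add_cls [simp]: "cls A \<oplus>\<^bsub>Dquot L\<^esub> cls B = cls (A + B)"
  using abelian_subgroup.a_rcos_sum[OF ideal.axioms(1)[OF ideal, THEN abelian_subgroupI3], of A B]
    ring.is_abelian_group[OF ring_OreRing]
  by (simp add: Dquot_def FactRing_simps cls_def additive_subgroup_def)

lemma mult_cls [simp]: "cls A \<otimes>\<^bsub>Dquot L\<^esub> cls B = cls (ore_mult A B)"
  using ideal.rcoset_mult_add[OF ideal, of A B] by (simp add: Dquot_def FactRing_def cls_def)

lemma one_Dquot: "\<one>\<^bsub>Dquot L\<^esub> = cls 1"
  by (simp add: Dquot_def FactRing_def cls_def)

lemma zero_Dquot: "\<zero>\<^bsub>Dquot L\<^esub> = cls 0"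
  by (simp add: Dquot_def FactRing_def cls_eq left_ideal_gen_eq)

lemma finsum_cls: "finite I \<Longrightarrow> finsum (Dquot L) (\<lambda>i. cls (f i)) I = cls (sum f I)"
proof (induction I rule: finite_induct)
  case empty
  interpret ring "Dquot L" by (rule ring_Dquot)
  show ?case by (simp add: zero_Dquot)
next
  case (insert i I)
  interpret ring "Dquot L" by (rule ring_Dquot)
  show ?case
    using insert by (simp add: finsum_insert)
qed

lemma central_operator_power: "central_operator (L ^ n)"
proof (induction n)
  case 0
  show ?case by unfold_locales simp_all
next
  case (Suc n)
  interpret P: central_operator "L ^ n" by (rule Suc.IH)
  show ?case
    by unfold_locales (simp_all add: map_poly_ddt_mult const P.const ore_mult_left P.left)
qed

text \<open>Bridges the powers in the operator ring, used in the theorem, and the powers of symbols,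
  used in the proof.\<close>

lemma OreRing_power: "L [^]\<^bsub>OreRing\<^esub> (n :: nat) = L ^ n"
proof (induction n)
  case (Suc n)
  interpret P: central_operator "L ^ n" by (rule central_operator_power)
  show ?case
    using Suc.IH by (simp add: nat_pow_def P.left mult.commute)
qed (simp add: nat_pow_def)

end

subsection \<open>Truncated polynomials\<close>

locale splitting = central_operator M for M :: "'k::field poly fract poly" +
  fixes \<nu> :: nat and \<Phi> :: "'k poly fract poly \<Rightarrow> 'k poly fract poly"
  assumes nonzero: "M \<noteq> 0" and \<nu>: "\<nu> \<ge> 1"
    and \<Phi>_add: "\<Phi> (A + B) = \<Phi> A + \<Phi> B" and \<Phi>_1: "\<Phi> 1 = 1"
    and \<Phi>_mult: "\<Phi> (ore_mult A B) = ore_mult (\<Phi> A) (\<Phi> B)"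
    and \<Phi>_cong: "M dvd \<Phi> A - A"
    and \<Phi>_dvd: "M dvd A \<Longrightarrow> M ^ \<nu> dvd \<Phi> A"
begin

sublocale pow: central_operator "M ^ n" for n
  by (rule central_operator_power)

abbreviation R where "R \<equiv> Dquot M"
abbreviation Q where "Q \<equiv> Dquot (M ^ \<nu>)"
abbreviation P where "P \<equiv> UP R"

sublocale UP_ring R P
  by (simp add: UP_ring_def ring_Dquot)

lemma \<Phi>_0: "\<Phi> 0 = 0"
  by (metis add.right_neutral add_left_cancel \<Phi>_add)

lemma \<Phi>_diff: "\<Phi> (A - B) = \<Phi> A - \<Phi> B"
  using \<Phi>_add[of "A - B" B] by simp

lemma \<Phi>_sum: "\<Phi> (sum f I) = (\<Sum>i\<in>I. \<Phi> (f i))"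
  by (induction I rule: infinite_finite_induct) (simp_all add: \<Phi>_0 \<Phi>_add)

section \<open>Expansions in powers of M and evaluation at T = M\<close>

definition expand :: "(nat \<Rightarrow> 'k poly fract poly) \<Rightarrow> 'k poly fract poly" where
  "expand a = (\<Sum>i<\<nu>. \<Phi> (a i) * M ^ i)"

text \<open>Evaluation at T = M with coefficients lifted by \<Phi>. Coefficients are classes, so
  representatives are chosen; those from index \<nu> on are dropped because M^\<nu> is zero in the
  target.\<close>

definition \<Psi> :: "(nat \<Rightarrow> 'k poly fract poly set) \<Rightarrow> 'k poly fract poly set" where
  "\<Psi> f = pow.cls \<nu> (expand (\<lambda>i. SOME A. f i = cls A))"

text \<open>Two representatives of a class differ by a multiple of M, and \<Phi> sends it to a
  multiple of M^\<nu>.\<close>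

lemma \<Psi>_eq:
  assumes "\<And>i. i < \<nu> \<Longrightarrow> f i = cls (a i)"
  shows "\<Psi> f = pow.cls \<nu> (expand a)"
proof -
  define r where "r = (\<lambda>i. SOME A. f i = cls A)"
  have "M ^ \<nu> dvd \<Phi> (r i) * M ^ i - \<Phi> (a i) * M ^ i" if "i < \<nu>" for i
  proof -
    have "f i = cls (r i)"
      unfolding r_def by (rule someI) (rule assms[OF that])
    then have "cls (r i) = cls (a i)"
      using assms[OF that] by simp
    then have "M ^ \<nu> dvd \<Phi> (r i) - \<Phi> (a i)"
      unfolding cls_eq_iff \<Phi>_diff[symmetric] by (rule \<Phi>_dvd)
    then show ?thesis
      by (simp flip: left_diff_distrib)
  qed
  then have "M ^ \<nu> dvd expand r - expand a"
    unfolding expand_def sum_subtractf[symmetric] by (intro dvd_sum) simp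
  then show ?thesis
    by (simp add: \<Psi>_def pow.cls_eq_iff r_def)
qed

lemma carrier_P: "f \<in> carrier P \<longleftrightarrow> (\<forall>i. f i \<in> carrier R) \<and> (\<exists>n. bound \<zero>\<^bsub>R\<^esub> n f)"
  by (simp add: UP_def up_def Pi_def)

lemma representatives:
  assumes "f \<in> carrier P"
  shows "\<exists>a. \<forall>i. f i = cls (a i)"
  using assms unfolding carrier_P carrier_Dquot by (intro choice) blast

lemma mult_P_apply:
  "f \<in> carrier P \<Longrightarrow> g \<in> carrier P \<Longrightarrow>
    (f \<otimes>\<^bsub>P\<^esub> g) n = finsum R (\<lambda>i. f i \<otimes>\<^bsub>R\<^esub> g (n - i)) {..n}"
  by (simp add: UP_def)

lemma ore_mult_powers: "ore_mult (A * M ^ i) (B * M ^ j) = ore_mult A B * M ^ (i + j)"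
  using pow.ore_mult_left[of i A "M ^ j * B"] pow.ore_mult_right[of A j B]
  by (simp add: mult_ac power_add)

lemma ore_mult_sum_left: "ore_mult (sum f I) B = (\<Sum>i\<in>I. ore_mult (f i) B)"
  by (induction I rule: infinite_finite_induct) (simp_all add: ore_mult_distrib_right)

lemma ore_mult_sum_right: "ore_mult A (sum f I) = (\<Sum>i\<in>I. ore_mult A (f i))"
  by (induction I rule: infinite_finite_induct) (simp_all add: ore_mult_distrib_left)

text \<open>The product of the sums runs over a square of index pairs, the convolution over a
  triangle; every other pair has i + j at least \<nu>.\<close>

lemma expand_mult:
  "M ^ \<nu> dvd ore_mult (expand a) (expand b) - expand (\<lambda>n. \<Sum>i\<le>n. ore_mult (a i) (b (n - i)))"
proof -
  define g where "g i j = ore_mult (\<Phi> (a i)) (\<Phi> (b j)) * M ^ (i + j)" for i j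
  have "ore_mult (expand a) (expand b) = (\<Sum>(i, j)\<in>{..<\<nu>} \<times> {..<\<nu>}. g i j)"
    unfolding expand_def ore_mult_sum_left
    by (simp add: ore_mult_sum_right ore_mult_powers g_def sum.cartesian_product)
  moreover have "expand (\<lambda>n. \<Sum>i\<le>n. ore_mult (a i) (b (n - i))) = (\<Sum>n<\<nu>. \<Sum>i\<le>n. g i (n - i))"
    by (simp add: expand_def \<Phi>_sum \<Phi>_mult sum_distrib_right g_def)
  moreover have "\<dots> = (\<Sum>(i, j)\<in>{(i, j). i + j < \<nu>}. g i j)"
    by (rule sum.triangle_reindex[symmetric])
  moreover have "(\<Sum>(i, j)\<in>{..<\<nu>} \<times> {..<\<nu>}. g i j) =
      (\<Sum>(i, j)\<in>{..<\<nu>} \<times> {..<\<nu>} - {(i, j). i + j < \<nu>}. g i j) + (\<Sum>(i, j)\<in>{(i, j). i + j < \<nu>}. g i j)"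
    by (rule sum.subset_diff) auto
  moreover have "M ^ \<nu> dvd (\<Sum>(i, j)\<in>{..<\<nu>} \<times> {..<\<nu>} - {(i, j). i + j < \<nu>}. g i j)"
    by (rule dvd_sum) (auto simp: g_def le_imp_power_dvd dvd_mult)
  ultimately show ?thesis
    by simp
qed

lemma \<Psi>_hom: "\<Psi> \<in> ring_hom P Q"
proof (rule ring_hom_memI)
  fix f g assume f: "f \<in> carrier P" and g: "g \<in> carrier P"
  obtain a where a: "\<And>i. f i = cls (a i)"
    using representatives[OF f] by blast
  obtain b where b: "\<And>i. g i = cls (b i)"
    using representatives[OF g] by blast
  have \<Psi>fg: "\<Psi> f = pow.cls \<nu> (expand a)" "\<Psi> g = pow.cls \<nu> (expand b)"
    by (simp_all add: \<Psi>_eq a b)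
  show "\<Psi> f \<in> carrier Q"
    by (simp add: \<Psi>fg)
  have "\<Psi> (f \<oplus>\<^bsub>P\<^esub> g) = pow.cls \<nu> (expand (\<lambda>i. a i + b i))"
    by (rule \<Psi>_eq) (use f g a b in \<open>simp add: UP_def\<close>)
  then show "\<Psi> (f \<oplus>\<^bsub>P\<^esub> g) = \<Psi> f \<oplus>\<^bsub>Q\<^esub> \<Psi> g"
    by (simp add: \<Psi>fg expand_def \<Phi>_add distrib_right sum.distrib)
  have "\<Psi> (f \<otimes>\<^bsub>P\<^esub> g) = pow.cls \<nu> (expand (\<lambda>n. \<Sum>i\<le>n. ore_mult (a i) (b (n - i))))"
    by (rule \<Psi>_eq) (simp add: mult_P_apply[OF f g] a b finsum_cls)
  then show "\<Psi> (f \<otimes>\<^bsub>P\<^esub> g) = \<Psi> f \<otimes>\<^bsub>Q\<^esub> \<Psi> g"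
    using expand_mult[of a b] by (simp add: \<Psi>fg pow.cls_eq_iff dvd_diff_commute)
next
  have "\<Psi> \<one>\<^bsub>P\<^esub> = pow.cls \<nu> (expand (\<lambda>i. if i = 0 then 1 else 0))"
    by (rule \<Psi>_eq) (simp add: UP_def one_Dquot zero_Dquot)
  also have "expand (\<lambda>i. if i = 0 then 1 else 0) = (\<Sum>i<\<nu>. if i = 0 then 1 else 0)"
    unfolding expand_def by (rule sum.cong) (simp_all add: \<Phi>_0 \<Phi>_1)
  also have "\<dots> = 1"
    using \<nu> by simp
  finally show "\<Psi> \<one>\<^bsub>P\<^esub> = \<one>\<^bsub>Q\<^esub>"
    by (simp add: pow.one_Dquot)
qed

sublocale ring_hom_ring P Q \<Psi>
  by (rule ring_hom_ringI2[OF UP_ring pow.ring_Dquot \<Psi>_hom])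

lemma expand_exhaust: "\<exists>a. M ^ k dvd A - (\<Sum>i<k. \<Phi> (a i) * M ^ i)"
proof (induction k)
  case (Suc k)
  then obtain a B where aB: "A - (\<Sum>i<k. \<Phi> (a i) * M ^ i) = M ^ k * B"
    unfolding dvd_def by blast
  \<comment> \<open>The cofactor \<open>B\<close> itself serves as the next digit, since \<Phi>
    changes it only by a multiple of M.\<close>
  have "A - (\<Sum>i<Suc k. \<Phi> ((a(k := B)) i) * M ^ i) = M ^ k * B - \<Phi> B * M ^ k"
    by (simp flip: aB)
  also have "\<dots> = - (M ^ k * (\<Phi> B - B))"
    by (simp add: algebra_simps)
  finally have "M ^ Suc k dvd A - (\<Sum>i<Suc k. \<Phi> ((a(k := B)) i) * M ^ i)"
    using \<Phi>_cong[of B] by (simp add: mult.commute[of M] mult_dvd_mono)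
  then show ?case
    by blast
qed simp

lemma \<Psi>_surj: "\<Psi> ` carrier P = carrier Q"
proof
  show "carrier Q \<subseteq> \<Psi> ` carrier P"
  proof
    fix X assume "X \<in> carrier Q"
    then obtain A where X: "X = pow.cls \<nu> A"
      by (auto simp: pow.carrier_Dquot)
    obtain a where a: "M ^ \<nu> dvd A - expand a"
      unfolding expand_def using expand_exhaust by blast
    define f where "f i = (if i < \<nu> then cls (a i) else \<zero>\<^bsub>R\<^esub>)" for i
    have "bound \<zero>\<^bsub>R\<^esub> \<nu> f"
      by (auto simp: f_def)
    then have "f \<in> carrier P"
      by (auto simp: carrier_P f_def zero_Dquot)
    moreover have "\<Psi> f = X"
      using \<Psi>_eq[of f a] a by (simp add: f_def X pow.cls_eq_iff dvd_diff_commute)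
    ultimately show "X \<in> \<Psi> ` carrier P"
      by blast
  qed
qed auto

text \<open>Uniqueness of digits: by induction the terms below \<open>k\<close> vanish modulo
  M^\<nu>, those above carry M^(k+1), and M^k is cancelled from the remaining one.\<close>

lemma expand_dvd_coeff:
  assumes "M ^ \<nu> dvd expand a" "k < \<nu>"
  shows "M dvd a k"
  using assms(2)
proof (induction k rule: less_induct)
  case (less k)
  have le: "M ^ Suc k dvd M ^ \<nu>"
    using less.prems by (intro le_imp_power_dvd) simp
  have others: "M ^ Suc k dvd \<Phi> (a i) * M ^ i" if i: "i \<in> {..<\<nu>} - {k}" for i
  proof (cases "i < k")
    case True
    then have "M ^ \<nu> dvd \<Phi> (a i)"
      using less.IH i \<Phi>_dvd by simp
    then show ?thesis
      using dvd_trans[OF le] by (simp add: dvd_mult2 del: power_Suc)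
  next
    case False
    then show ?thesis
      using i by (intro dvd_mult le_imp_power_dvd) simp
  qed
  have "expand a = \<Phi> (a k) * M ^ k + (\<Sum>i\<in>{..<\<nu>} - {k}. \<Phi> (a i) * M ^ i)"
    unfolding expand_def by (rule sum.remove) (use less.prems in auto)
  moreover have "M ^ Suc k dvd (\<Sum>i\<in>{..<\<nu>} - {k}. \<Phi> (a i) * M ^ i)"
    by (rule dvd_sum) (rule others)
  ultimately have "M ^ Suc k dvd \<Phi> (a k) * M ^ k"
    using dvd_trans[OF le assms(1)] by (simp only: dvd_add_left_iff)
  then have "M dvd \<Phi> (a k)"
    using nonzero by simp
  then show ?case
    using dvd_diff[OF _ \<Phi>_cong[of "a k"], of "\<Phi> (a k)"] by simp
qed

lemma \<Psi>_eq_zero_iff: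
  assumes "f \<in> carrier P"
  shows "\<Psi> f = \<zero>\<^bsub>Q\<^esub> \<longleftrightarrow> (\<forall>i<\<nu>. f i = \<zero>\<^bsub>R\<^esub>)"
proof
  obtain a where a: "\<And>i. f i = cls (a i)"
    using representatives[OF assms] by blast
  assume "\<Psi> f = \<zero>\<^bsub>Q\<^esub>"
  then have "M ^ \<nu> dvd expand a"
    by (simp add: \<Psi>_eq[of f a] a pow.zero_Dquot pow.cls_eq_iff)
  then show "\<forall>i<\<nu>. f i = \<zero>\<^bsub>R\<^esub>"
    using expand_dvd_coeff by (simp add: a zero_Dquot cls_eq_iff)
next
  assume "\<forall>i<\<nu>. f i = \<zero>\<^bsub>R\<^esub>"
  then have "\<Psi> f = pow.cls \<nu> (expand (\<lambda>i. 0))"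
    by (intro \<Psi>_eq) (simp add: zero_Dquot)
  then show "\<Psi> f = \<zero>\<^bsub>Q\<^esub>"
    by (simp add: expand_def \<Phi>_0 pow.zero_Dquot)
qed

definition T where "T = up_ring.monom P \<one>\<^bsub>R\<^esub> 1"

lemma T_power: "T [^]\<^bsub>P\<^esub> n = up_ring.monom P \<one>\<^bsub>R\<^esub> n" for n :: nat
proof (induction n)
  case (Suc n)
  then show ?case
    unfolding T_def using monom_one_Suc[of n] by simp
qed simp

lemma monom_apply: "up_ring.monom P \<one>\<^bsub>R\<^esub> n = (\<lambda>i. if i = n then \<one>\<^bsub>R\<^esub> else \<zero>\<^bsub>R\<^esub>)"
  by (simp add: UP_def)

lemma kernel_eq: "a_kernel P Q \<Psi> = Idl\<^bsub>P\<^esub> {T [^]\<^bsub>P\<^esub> \<nu>}"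
proof
  have T: "T [^]\<^bsub>P\<^esub> \<nu> \<in> carrier P"
    by (simp add: T_power)
  show "Idl\<^bsub>P\<^esub> {T [^]\<^bsub>P\<^esub> \<nu>} \<subseteq> a_kernel P Q \<Psi>"
  proof (rule P.genideal_minimal[OF kernel_is_ideal])
    have "\<Psi> (T [^]\<^bsub>P\<^esub> \<nu>) = \<zero>\<^bsub>Q\<^esub>"
      unfolding \<Psi>_eq_zero_iff[OF T] by (simp add: T_power monom_apply)
    then show "{T [^]\<^bsub>P\<^esub> \<nu>} \<subseteq> a_kernel P Q \<Psi>"
      using T unfolding a_kernel_def' by blast
  qed
  show "a_kernel P Q \<Psi> \<subseteq> Idl\<^bsub>P\<^esub> {T [^]\<^bsub>P\<^esub> \<nu>}"
  proof
    fix f assume "f \<in> a_kernel P Q \<Psi>"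
    then have f: "f \<in> carrier P" and low: "\<And>i. i < \<nu> \<Longrightarrow> f i = \<zero>\<^bsub>R\<^esub>"
      using \<Psi>_eq_zero_iff[of f] unfolding a_kernel_def' by blast+
    \<comment> \<open>The quotient of \<open>f\<close> by T^\<nu>: shifting the coefficients down
      loses nothing, by \<open>low\<close>.\<close>
    define g where "g i = f (i + \<nu>)" for i
    obtain n where "bound \<zero>\<^bsub>R\<^esub> n f"
      using f unfolding carrier_P by blast
    then have "bound \<zero>\<^bsub>R\<^esub> n g"
      by (auto simp: g_def bound_def)
    then have g: "g \<in> carrier P"
      using f by (auto simp: carrier_P g_def)
    obtain b where b: "\<And>i. g i = cls (b i)"
      using representatives[OF g] by blast
    have "f = g \<otimes>\<^bsub>P\<^esub> (T [^]\<^bsub>P\<^esub> \<nu>)"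
    proof
      fix k
      \<comment> \<open>Subtraction is truncated: without the guard \<open>\<nu> \<le> k\<close> the
        index 0 would wrongly be selected for small \<open>k\<close>.\<close>
      have "(\<Sum>i\<le>k. if k - i = \<nu> then b i else 0) = (\<Sum>i\<le>k. if i = k - \<nu> then (if \<nu> \<le> k then b i else 0) else 0)"
        by (rule sum.cong) auto
      also have "\<dots> = (if \<nu> \<le> k then b (k - \<nu>) else 0)"
        by simp
      finally have sum: "(\<Sum>i\<le>k. if k - i = \<nu> then b i else 0) = (if \<nu> \<le> k then b (k - \<nu>) else 0)" .
      have "(T [^]\<^bsub>P\<^esub> \<nu>) i = cls (if i = \<nu> then 1 else 0)" for i
        unfolding T_power monom_apply by (simp add: one_Dquot zero_Dquot)
      then have "(g \<otimes>\<^bsub>P\<^esub> (T [^]\<^bsub>P\<^esub> \<nu>)) k = cls (\<Sum>i\<le>k. ore_mult (b i) (if k - i = \<nu> then 1 else 0))"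
        by (simp only: mult_P_apply[OF g T] b mult_cls finsum_cls[OF finite_atMost])
      also have "(\<Sum>i\<le>k. ore_mult (b i) (if k - i = \<nu> then 1 else 0)) = (\<Sum>i\<le>k. if k - i = \<nu> then b i else 0)"
        by (rule sum.cong) auto
      also have "cls \<dots> = f k"
      proof (cases "\<nu> \<le> k")
        case True
        then show ?thesis
          unfolding sum by (simp flip: b add: g_def)
      next
        case False
        then have "f k = \<zero>\<^bsub>R\<^esub>"
          by (intro low) simp
        with False show ?thesis
          unfolding sum by (simp add: zero_Dquot)
      qed
      finally show "f k = (g \<otimes>\<^bsub>P\<^esub> (T [^]\<^bsub>P\<^esub> \<nu>)) k" ..
    qed
    moreover have "T [^]\<^bsub>P\<^esub> \<nu> \<in> Idl\<^bsub>P\<^esub> {T [^]\<^bsub>P\<^esub> \<nu>}"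
      using P.genideal_self'[OF T] .
    ultimately show "f \<in> Idl\<^bsub>P\<^esub> {T [^]\<^bsub>P\<^esub> \<nu>}"
      using ideal.I_l_closed[OF P.genideal_ideal, of "{T [^]\<^bsub>P\<^esub> \<nu>}"] g T by simp
  qed
qed

lemma \<Psi>_T: "\<Psi> T = pow.cls \<nu> M"
proof -
  have "\<Psi> T = pow.cls \<nu> (expand (\<lambda>i. if i = 1 then 1 else 0))"
    unfolding T_def monom_apply by (rule \<Psi>_eq) (simp add: one_Dquot zero_Dquot)
  also have "expand (\<lambda>i. if i = 1 then 1 else 0) = (\<Sum>i<\<nu>. if i = 1 then M else 0)"
    unfolding expand_def by (rule sum.cong) (simp_all add: \<Phi>_0 \<Phi>_1)
  \<comment> \<open>For \<open>\<nu> = 1\<close> the coefficient at index 1 is cut off and the sum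
    is 0, but then M is itself zero in the quotient.\<close>
  also have "pow.cls \<nu> \<dots> = pow.cls \<nu> M"
    using \<nu> by (cases "\<nu> = 1") (simp_all add: pow.cls_eq_iff cls_eq_iff)
  finally show ?thesis .
qed

text \<open>The first isomorphism theorem gives a map out of the polynomial quotient. The required
  map is its inverse, whose value at the class of M is identified by injectivity.\<close>

lemma Dquot_power_iso:
  "\<exists>h \<in> ring_iso Q (P Quot Idl\<^bsub>P\<^esub> {T [^]\<^bsub>P\<^esub> \<nu>}).
    h (pow.cls \<nu> M) = Idl\<^bsub>P\<^esub> {T [^]\<^bsub>P\<^esub> \<nu>} +>\<^bsub>P\<^esub> T"
proof -
  let ?S = "P Quot a_kernel P Q \<Psi>" and ?F = "\<lambda>X. the_elem (\<Psi> ` X)"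
  have F: "?F \<in> ring_iso ?S Q"
    by (rule FactRing_iso_set[OF \<Psi>_surj])
  have S: "ring ?S"
    by (rule ideal.quotient_is_ring[OF kernel_is_ideal])
  have T: "T \<in> carrier P"
    by (simp add: T_def)
  have "a_kernel P Q \<Psi> +>\<^bsub>P\<^esub> T \<in> carrier ?S"
    using T by (auto simp: FactRing_simps)
  moreover have "?F (a_kernel P Q \<Psi> +>\<^bsub>P\<^esub> T) = pow.cls \<nu> M"
    by (simp add: T \<Psi>_T)
  ultimately have "inv_into (carrier ?S) ?F (pow.cls \<nu> M) = a_kernel P Q \<Psi> +>\<^bsub>P\<^esub> T"
    using F by (metis (no_types, lifting) bij_betw_def inv_into_f_f ring_iso_memE(5))
  then show ?thesis
    using ring_iso_set_sym[OF S F] kernel_eq by auto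
qed

end

theorem mainTheorem4:
  fixes N :: "'k::{field,finite} poly fract poly" and \<nu> :: nat
  assumes "poly_over Ftp N"
    and "lead_coeff N = 1"
    and "irreducible_over Ftp N"
    and "separable_over Ftp N"
    and "\<nu> \<ge> 1"
  shows "\<exists>h \<in> ring_iso (Dquot (at_dp N [^]\<^bsub>OreRing\<^esub> \<nu>))
              (UP (Dquot (at_dp N)) Quot
                 Idl\<^bsub>UP (Dquot (at_dp N))\<^esub>
                   {up_ring.monom (UP (Dquot (at_dp N))) \<one>\<^bsub>Dquot (at_dp N)\<^esub> 1 [^]\<^bsub>UP (Dquot (at_dp N))\<^esub> \<nu>}).
           h (left_ideal_gen (at_dp N [^]\<^bsub>OreRing\<^esub> \<nu>) +>\<^bsub>OreRing\<^esub> at_dp N)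
             = (Idl\<^bsub>UP (Dquot (at_dp N))\<^esub>
                   {up_ring.monom (UP (Dquot (at_dp N))) \<one>\<^bsub>Dquot (at_dp N)\<^esub> 1 [^]\<^bsub>UP (Dquot (at_dp N))\<^esub> \<nu>})
               +>\<^bsub>UP (Dquot (at_dp N))\<^esub> up_ring.monom (UP (Dquot (at_dp N))) \<one>\<^bsub>Dquot (at_dp N)\<^esub> 1"
proof -
  have "N \<noteq> 0"
    using assms(2) by auto
  then have M: "at_dp N \<noteq> 0"
    unfolding at_dp_eq_pcompose
    by (subst pcompose_eq_0_iff) (simp_all add: degree_monom_eq finite_imp_CHAR_pos)
  interpret central_operator "at_dp N"
    by unfold_locales (simp_all add: map_poly_ddt_at_dp assms(1) ore_mult_at_dp)
  obtain \<Phi> where \<Phi>: "\<And>A B. \<Phi> (A + B) = \<Phi> A + \<Phi> B" "\<Phi> 1 = 1"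
    "\<And>A B. \<Phi> (ore_mult A B) = ore_mult (\<Phi> A) (\<Phi> B)"
    "\<And>A. at_dp N dvd \<Phi> A - A" "\<And>A. at_dp N dvd A \<Longrightarrow> at_dp N ^ \<nu> dvd \<Phi> A"
    using exists_splitting[OF assms(4) \<open>N \<noteq> 0\<close> assms(5)] by blast
  interpret splitting "at_dp N" \<nu> \<Phi>
    by unfold_locales (fact M assms(5) \<Phi>)+
  show ?thesis
    using Dquot_power_iso unfolding pow.cls_def T_def OreRing_power .
qed

end
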